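(* Let $N$ be the natural colouring, $N^k(n)=k(n-k+1)$, and let $N_q$ be the $q$-colouring, $N_q^k(n)=[k]_q[n-k+1]_q$ with $q=\exp(h)$ and $[k]_q=\frac{q^k-q^{-k}}{q-q^{-1}}$. Then, as $U_h(\mathfrak a)$-algebras: - $U(\mathfrak{sl}_2)[[h]]$ is isomorphic to $U_h(N)$; - $U_h(\mathfrak{sl}_2)$ is isomorphic to $U_h(N_q)$.
   Context: $\mathbb k$ is a field of characteristic zero, and $\mathbb k[[h]]$ is the ring of formal power series over $\mathbb k$. For a $\mathbb k$-vector space $V_0$, $V_0[[h]]$ denotes the module of formal series $\sum_{m\ge0}v_mh^m$ with $v_m\in V_0$. $\mathfrak a$ is the Lie algebra over $\mathbb k$ generated by $H,X^-,X^+$ subject to $[H,X^\pm]=\pm2X^\pm$. We set $U_h(\mathfrak a):=U(\mathfrak a)[[h]]$. A $U_h(\mathfrak a)$-algebra is an algebra with a structural homomorphism from $U_h(\mathfrak a)$, and homomorphisms of $U_h(\mathfrak a)$-algebras must commute with the structural maps. $U(\mathfrak{sl}_2)[[h]]$ is a $U_h(\mathfrak a)$-algebra via the canonical projection. The quantum algebra $U_h(\mathfrak{sl}_2)$ is the quotient of $U_h(\mathfrak a)$ by the smallest $h$-adically closed two-sided ideal containing $$[X^+,X^-]-\frac{q^H-q^{-H}}{q-q^{-1}},\qquad q=\exp(h),\ q^H=\exp(hH).$$ A colouring is a sequence $\psi=(\psi^k)_{k\ge1}$ of functions $\psi^k:\mathbb Z\to\mathbb k[[h]]$ satisfying: - (C1)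 $\psi^k(n)\equiv k(n-k+1)\bmod h$; - (C2) $\psi^{n+1}(n)=0$ for all $n\ge0$; - (C3) $\psi^{n+k+1}(n)=\psi^k(-n-2)$ for all $k\ge1$ and all $n\ge0$. $V_h(n,\psi)$ is the representation of $U_h(\mathfrak a)$ on $(\bigoplus_{k\ge0}\mathbb k b_k)[[h]]$ with the following action: - $H.b_k=(n-2k)b_k$; - $X^-.b_k=b_{k+1}$; - $X^+.b_0=0$, and $X^+.b_k=\psi^k(n)b_{k-1}$ for $k\ge1$. $U_h(\psi)$ is the quotient of $U_h(\mathfrak a)$ by the two-sided ideal of elements that act by zero on $V_h(n,\psi)$ for all $n\in\mathbb Z$. It is a $U_h(\mathfrak a)$-algebra via the projection. *)

theory Defs
  imports "HOL-Algebra.Algebra" "HOL-Computational_Algebra.Formal_Power_Series"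
begin

datatype agen = GH | GXm | GXp

type_synonym 'k fa = "agen list \<Rightarrow> 'k"

text \<open>Elements: finitely supported coefficient functions on words; product
 is concatenation of words, extended bilinearly.\<close>

definition fa_mult :: "'k::field fa \<Rightarrow> 'k fa \<Rightarrow> 'k fa" where
  "fa_mult f g = (\<lambda>w. \<Sum>i\<le>length w. f (take i w) * g (drop i w))"

definition free_alg :: "('k::field fa) ring" where
  "free_alg = \<lparr>carrier = {f. finite {w. f w \<noteq> 0}}, monoid.mult = fa_mult,
      one = (\<lambda>w. if w = [] then 1 else 0), ring.zero = (\<lambda>w. 0),
      ring.add = (\<lambda>f g w. f w + g w)\<rparr>"

definition fa_gen :: "agen \<Rightarrow> 'k::field fa" where
  "fa_gen g = (\<lambda>w. if w = [g] then 1 else 0)"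

definition fa_scal :: "'k::field \<Rightarrow> 'k fa \<Rightarrow> 'k fa" where
  "fa_scal c f = (\<lambda>w. c * f w)"

definition fa_comm :: "'k::field fa \<Rightarrow> 'k fa \<Rightarrow> 'k fa" where
  "fa_comm x y = (\<lambda>w. fa_mult x y w - fa_mult y x w)"

definition rel_Xp :: "'k::field fa" where
  "rel_Xp = (\<lambda>w. fa_comm (fa_gen GH) (fa_gen GXp) w - 2 * fa_gen GXp w)"

definition rel_Xm :: "'k::field fa" where
  "rel_Xm = (\<lambda>w. fa_comm (fa_gen GH) (fa_gen GXm) w + 2 * fa_gen GXm w)"

definition rel_sl2 :: "'k::field fa" where
  "rel_sl2 = (\<lambda>w. fa_comm (fa_gen GXp) (fa_gen GXm) w - fa_gen GH w)"

definition Ia :: "'k::field fa set" where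
  "Ia = genideal free_alg {rel_Xp, rel_Xm}"

definition Isl2 :: "'k::field fa set" where
  "Isl2 = genideal free_alg {rel_Xp, rel_Xm, rel_sl2}"

definition Ua :: "('k::field fa set) ring" where
  "Ua = free_alg Quot Ia"

definition Usl2 :: "('k::field fa set) ring" where
  "Usl2 = free_alg Quot Isl2"

definition cls :: "'k::field fa \<Rightarrow> 'k fa set" where
  "cls f = Ia +>\<^bsub>free_alg\<^esub> f"

definition pseries :: "('a, 'm) ring_scheme \<Rightarrow> (nat \<Rightarrow> 'a) ring" where
  "pseries R = \<lparr>carrier = {f. \<forall>n. f n \<in> carrier R},
      monoid.mult = (\<lambda>f g n. finsum R (\<lambda>i. f i \<otimes>\<^bsub>R\<^esub> g (n - i)) {..n}),
      one = (\<lambda>n. if n = 0 then \<one>\<^bsub>R\<^esub> else \<zero>\<^bsub>R\<^esub>),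
      ring.zero = (\<lambda>n. \<zero>\<^bsub>R\<^esub>),
      ring.add = (\<lambda>f g n. f n \<oplus>\<^bsub>R\<^esub> g n)\<rparr>"

definition Uha :: "(nat \<Rightarrow> 'k::field fa set) ring" where
  "Uha = pseries Ua"

definition Uh_scal :: "'k::field fps \<Rightarrow> nat \<Rightarrow> 'k fa set" where
  "Uh_scal c = (\<lambda>n. cls (fa_scal (fps_nth c n) \<one>\<^bsub>free_alg\<^esub>))"

definition Uh_gen :: "agen \<Rightarrow> nat \<Rightarrow> 'k::field fa set" where
  "Uh_gen g = (\<lambda>n. if n = 0 then cls (fa_gen g) else \<zero>\<^bsub>Ua\<^esub>)"

definition Uh_expH :: "'k::field_char_0 \<Rightarrow> nat \<Rightarrow> 'k fa set" where
  "Uh_expH c = (\<lambda>n. cls (fa_scal (c ^ n / fact n) (fa_gen GH [^]\<^bsub>free_alg\<^esub> n)))"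

text \<open>q = exp h.  The element (q^H - q^{-H})/(q - q^{-1}) of U_h(a) is the
 unique x with (q - q^{-1}) x = q^H - q^{-H}.\<close>

definition qH_quot :: "nat \<Rightarrow> 'k::field_char_0 fa set" where
  "qH_quot = (THE x. x \<in> carrier Uha \<and>
      Uh_scal (fps_exp 1 - fps_exp (-1)) \<otimes>\<^bsub>Uha\<^esub> x = Uh_expH 1 \<ominus>\<^bsub>Uha\<^esub> Uh_expH (-1))"

definition Uh_rel :: "nat \<Rightarrow> 'k::field_char_0 fa set" where
  "Uh_rel = (Uh_gen GXp \<otimes>\<^bsub>Uha\<^esub> Uh_gen GXm \<ominus>\<^bsub>Uha\<^esub> Uh_gen GXm \<otimes>\<^bsub>Uha\<^esub> Uh_gen GXp)
             \<ominus>\<^bsub>Uha\<^esub> qH_quot"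

definition hadic_closed :: "(nat \<Rightarrow> 'k::field fa set) set \<Rightarrow> bool" where
  "hadic_closed S \<longleftrightarrow> (\<forall>f \<in> carrier Uha. (\<forall>N. \<exists>g\<in>S. \<forall>n<N. f n = g n) \<longrightarrow> f \<in> S)"

definition Jq :: "(nat \<Rightarrow> 'k::field_char_0 fa set) set" where
  "Jq = \<Inter>{I. ideal I Uha \<and> hadic_closed I \<and> Uh_rel \<in> I}"

definition Uh_sl2 :: "((nat \<Rightarrow> 'k::field_char_0 fa set) set) ring" where
  "Uh_sl2 = Uha Quot Jq"

definition quot_proj :: "(nat \<Rightarrow> 'k::field fa set) set \<Rightarrow> (nat \<Rightarrow> 'k fa set) \<Rightarrow> (nat \<Rightarrow> 'k fa set) set" where
  "quot_proj J x = J +>\<^bsub>Uha\<^esub> x"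

text \<open>Coefficientwise canonical projection U(a)[[h]] \<rightarrow> U(sl_2)[[h]]:
 a coset of Ia is sent to the coset of Isl2 containing it.\<close>

definition sl2_proj :: "(nat \<Rightarrow> 'k::field fa set) \<Rightarrow> (nat \<Rightarrow> 'k fa set)" where
  "sl2_proj x = (\<lambda>n. \<Union>{Isl2 +>\<^bsub>free_alg\<^esub> f | f. f \<in> x n})"

text \<open>Vectors of (\<Oplus>_k k b_k)[[h]]: coefficient functions k \<mapsto> k[[h]] such that
 each h-degree has finite support.\<close>

definition Vh :: "(nat \<Rightarrow> 'k::field fps) set" where
  "Vh = {c. \<forall>m. finite {k. fps_nth (c k) m \<noteq> 0}}"

text \<open>A colouring candidate psi is a function psi k n (k \<ge> 1 used).\<close>

definition gen_act :: "(nat \<Rightarrow> int \<Rightarrow> 'k::field fps) \<Rightarrow> int \<Rightarrow> agen \<Rightarrow> (nat \<Rightarrow> 'k fps) \<Rightarrow> (nat \<Rightarrow> 'k fps)" where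
  "gen_act psi n g c = (case g of
      GH \<Rightarrow> (\<lambda>k. of_int (n - 2 * int k) * c k)
    | GXm \<Rightarrow> (\<lambda>k. if k = 0 then 0 else c (k - 1))
    | GXp \<Rightarrow> (\<lambda>k. psi (k + 1) n * c (k + 1)))"

definition word_act :: "(nat \<Rightarrow> int \<Rightarrow> 'k::field fps) \<Rightarrow> int \<Rightarrow> agen list \<Rightarrow> (nat \<Rightarrow> 'k fps) \<Rightarrow> (nat \<Rightarrow> 'k fps)" where
  "word_act psi n w c = foldr (gen_act psi n) w c"

definition fa_act :: "(nat \<Rightarrow> int \<Rightarrow> 'k::field fps) \<Rightarrow> int \<Rightarrow> 'k fa \<Rightarrow> (nat \<Rightarrow> 'k fps) \<Rightarrow> (nat \<Rightarrow> 'k fps)" where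
  "fa_act psi n f c = (\<lambda>k. \<Sum>w | f w \<noteq> 0. fps_const (f w) * word_act psi n w c k)"

definition Ua_act :: "(nat \<Rightarrow> int \<Rightarrow> 'k::field fps) \<Rightarrow> int \<Rightarrow> 'k fa set \<Rightarrow> (nat \<Rightarrow> 'k fps) \<Rightarrow> (nat \<Rightarrow> 'k fps)" where
  "Ua_act psi n C c = fa_act psi n (SOME f. f \<in> C) c"

text \<open>x = sum_m x_m h^m acts by v \<mapsto> sum_m h^m (x_m . v).\<close>

definition Uha_act :: "(nat \<Rightarrow> int \<Rightarrow> 'k::field fps) \<Rightarrow> int \<Rightarrow> (nat \<Rightarrow> 'k fa set) \<Rightarrow> (nat \<Rightarrow> 'k fps) \<Rightarrow> (nat \<Rightarrow> 'k fps)" where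
  "Uha_act psi n x c = (\<lambda>k. Abs_fps (\<lambda>d. \<Sum>m\<le>d. fps_nth (Ua_act psi n (x m) c k) (d - m)))"

definition Ann :: "(nat \<Rightarrow> int \<Rightarrow> 'k::field fps) \<Rightarrow> (nat \<Rightarrow> 'k fa set) set" where
  "Ann psi = {x \<in> carrier Uha. \<forall>n::int. \<forall>c \<in> Vh. Uha_act psi n x c = (\<lambda>k. 0)}"

definition Uh_psi :: "(nat \<Rightarrow> int \<Rightarrow> 'k::field fps) \<Rightarrow> ((nat \<Rightarrow> 'k fa set) set) ring" where
  "Uh_psi psi = Uha Quot Ann psi"

definition natC :: "nat \<Rightarrow> int \<Rightarrow> 'k::field_char_0 fps" where
  "natC k n = of_int (int k * (n - int k + 1))"

text \<open>[k]_q = (q^k - q^{-k})/(q - q^{-1}) with q = exp h (exact division in k[[h]]).\<close>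

definition qint :: "int \<Rightarrow> 'k::field_char_0 fps" where
  "qint k = (fps_exp (of_int k) - fps_exp (- of_int k)) div (fps_exp 1 - fps_exp (-1))"

definition qC :: "nat \<Rightarrow> int \<Rightarrow> 'k::field_char_0 fps" where
  "qC k n = qint (int k) * qint (n - int k + 1)"

definition Uha_alg_iso ::
  "('b, 'c) ring_scheme \<Rightarrow> ((nat \<Rightarrow> 'k::field fa set) \<Rightarrow> 'b) \<Rightarrow> ('d, 'e) ring_scheme \<Rightarrow> ((nat \<Rightarrow> 'k fa set) \<Rightarrow> 'd) \<Rightarrow> bool" where
  "Uha_alg_iso A sA B sB \<longleftrightarrow>
     (\<exists>phi. phi \<in> ring_iso A B \<and> (\<forall>x \<in> carrier (Uha :: (nat \<Rightarrow> 'k fa set) ring). phi (sA x) = sB x))"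

end

theory Submission
  imports Defs "HOL-Computational_Algebra.Polynomial"
begin

text \<open>
  An element of \<open>U(\<aa>)\<close> whose action on all classical Verma modules \<open>V(n)\<close>, \<open>n \<in> \<int>\<close>, vanishes lies in
  the kernel of \<open>U(\<aa>) \<rightarrow> U(sl\<^sub>2)\<close>: modulo that kernel it is a combination of ordered monomials
  \<open>(X\<^sup>-)\<^sup>a H\<^sup>b (X\<^sup>+)\<^sup>c\<close>, and testing on the basis vectors \<open>b\<^sub>0, b\<^sub>1, \<dots>\<close> in turn shows that all coefficients
  vanish, being coefficients of polynomials in \<open>n\<close> with infinitely many roots.

  Let \<open>\<psi>\<close> be either colouring. Modulo \<open>h\<close> the module \<open>V\<^sub>h(n, \<psi>)\<close> is \<open>V(n)\<close>, so the constant term of an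
  annihilating series \<open>x\<close> lies in that kernel and lifts to the constant term of a series \<open>z\<close> in the
  ideal that defines \<open>U(sl\<^sub>2)[[h]]\<close> respectively \<open>U\<^sub>h(sl\<^sub>2)\<close>. Since \<open>z\<close> also annihilates, \<open>x - z = h x'\<close> with
  \<open>x'\<close> annihilating again. Iterating, and using that the ideal is \<open>h\<close>-adically closed, puts \<open>x\<close> itself
  into the ideal. The converse inclusion for the \<open>q\<close>-colouring is the identity
  \<open>[k+1]\<^sub>q [n-k]\<^sub>q - [k]\<^sub>q [n-k+1]\<^sub>q = [n-2k]\<^sub>q\<close>.
\<close>

section \<open>The free algebra and its quotients\<close>

definition fa_word :: "agen list \<Rightarrow> 'k::field fa" where
  "fa_word w = (\<lambda>u. if u = w then 1 else 0)"

lemma fa_mult_Nil: "fa_mult f g [] = f [] * g []"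
  by (simp add: fa_mult_def)

text \<open>Splits a word either before its first letter or somewhere after it. This recursion turns
  identities of the product into inductions on words.\<close>

lemma fa_mult_Cons: "fa_mult f g (x # w) = f [] * g (x # w) + fa_mult (\<lambda>u. f (x # u)) g w"
  by (simp add: fa_mult_def sum.atMost_Suc_shift del: sum.atMost_Suc)

lemma fa_mult_add_left: "fa_mult (\<lambda>u. f u + g u) h w = fa_mult f h w + fa_mult g h w"
  and fa_mult_add_right: "fa_mult h (\<lambda>u. f u + g u) w = fa_mult h f w + fa_mult h g w"
  and fa_mult_diff_left: "fa_mult (\<lambda>u. f u - g u) h w = fa_mult f h w - fa_mult g h w"
  and fa_mult_diff_right: "fa_mult h (\<lambda>u. f u - g u) w = fa_mult h f w - fa_mult h g w"
  and fa_mult_scale_left: "fa_mult (\<lambda>u. a * f u) h w = a * fa_mult f h w"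
  and fa_mult_scale_right: "fa_mult h (\<lambda>u. a * f u) w = a * fa_mult h f w"
  and fa_mult_zero_left: "fa_mult (\<lambda>u. 0) h w = 0"
  and fa_mult_zero_right: "fa_mult h (\<lambda>u. 0) w = 0"
  by (simp_all add: fa_mult_def algebra_simps sum.distrib sum_subtractf sum_distrib_left)

lemmas fa_mult_linear =
  fa_mult_add_left fa_mult_add_right fa_mult_diff_left fa_mult_diff_right
  fa_mult_scale_left fa_mult_scale_right fa_mult_zero_left fa_mult_zero_right

lemma fa_mult_assoc: "fa_mult (fa_mult f g) h w = fa_mult f (fa_mult g h) w"
\<comment> \<open>\<open>f\<close> is generalized because \<open>fa_mult_Cons\<close> replaces it by
  its shift \<open>\<lambda>u. f (x # u)\<close>.\<close>
proof (induction w arbitrary: f)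
  case (Cons x w)
  then show ?case
    by (simp add: fa_mult_Cons fa_mult_Nil fa_mult_linear algebra_simps)
qed (simp add: fa_mult_Nil)

lemma fa_mult_word_Nil_left: "fa_mult (fa_word []) f w = f w"
  by (cases w) (simp_all add: fa_mult_Nil fa_mult_Cons fa_mult_linear fa_word_def)

lemma fa_mult_word_Cons_left:
  "fa_mult (fa_word (x # u)) f w = (case w of [] \<Rightarrow> 0 | y # v \<Rightarrow> if x = y then fa_mult (fa_word u) f v else 0)"
  by (cases w) (auto simp: fa_mult_Nil fa_mult_Cons fa_mult_linear fa_word_def)

lemma fa_mult_word_word: "fa_mult (fa_word u) (fa_word v) = fa_word (u @ v)"
proof
  show "fa_mult (fa_word u) (fa_word v) w = fa_word (u @ v) w" for w
  proof (induction u arbitrary: w)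
    case Nil
    then show ?case by (simp add: fa_mult_word_Nil_left)
  next
    case (Cons x u)
    then show ?case
      by (simp add: fa_mult_word_Cons_left split: list.split) (simp add: fa_word_def)
  qed
qed

lemma fa_mult_word_Nil_right: "fa_mult f (fa_word []) w = f w"
  by (induction w arbitrary: f)
     (simp_all add: fa_mult_Nil fa_mult_Cons, simp_all add: fa_word_def)

lemma fa_gen_eq_word: "fa_gen g = fa_word [g]"
  by (simp add: fa_gen_def fa_word_def)

lemma free_alg_simps:
  "carrier free_alg = {f. finite {w. f w \<noteq> 0}}"
  "f \<otimes>\<^bsub>free_alg\<^esub> g = fa_mult f g"
  "\<one>\<^bsub>free_alg\<^esub> = fa_word []"
  "\<zero>\<^bsub>free_alg\<^esub> = (\<lambda>w. 0)"
  "f \<oplus>\<^bsub>free_alg\<^esub> g = (\<lambda>w. f w + g w)"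
  by (simp_all add: free_alg_def fa_word_def)

lemma fa_word_closed: "fa_word w \<in> carrier free_alg"
  by (simp add: free_alg_simps fa_word_def)

lemma fa_gen_closed: "fa_gen g \<in> carrier free_alg"
  by (simp add: fa_gen_eq_word fa_word_closed)

lemma fa_add_closed:
  assumes "f \<in> carrier free_alg" "g \<in> carrier free_alg"
  shows "(\<lambda>w. f w + g w) \<in> carrier free_alg"
proof -
  have "{w. f w + g w \<noteq> 0} \<subseteq> {w. f w \<noteq> 0} \<union> {w. g w \<noteq> 0}" by auto
  with assms show ?thesis
    by (auto simp: free_alg_simps intro: finite_subset)
qed

lemma fa_scale_closed:
  assumes "f \<in> carrier free_alg"
  shows "(\<lambda>w. a * f w) \<in> carrier free_alg"
proof -
  have "{w. a * f w \<noteq> 0} \<subseteq> {w. f w \<noteq> 0}" by auto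
  with assms show ?thesis
    by (auto simp: free_alg_simps intro: finite_subset)
qed

lemma fa_diff_closed:
  assumes "f \<in> carrier free_alg" "g \<in> carrier free_alg"
  shows "(\<lambda>w. f w - g w) \<in> carrier free_alg"
  using fa_add_closed[OF assms(1) fa_scale_closed[OF assms(2), of "-1"]] by simp

text \<open>The support of a product consists of concatenations of a word from one support with a
  word from the other.\<close>

lemma fa_mult_closed:
  assumes "f \<in> carrier free_alg" "g \<in> carrier free_alg"
  shows "fa_mult f g \<in> carrier free_alg"
proof -
  have "{w. fa_mult f g w \<noteq> 0} \<subseteq> (\<lambda>(u, v). u @ v) ` ({w. f w \<noteq> 0} \<times> {w. g w \<noteq> 0})"
  proof
    fix w assume "w \<in> {w. fa_mult f g w \<noteq> 0}"
    then obtain i where "f (take i w) * g (drop i w) \<noteq> 0"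
      unfolding fa_mult_def by (auto elim: sum.not_neutral_contains_not_neutral)
    then show "w \<in> (\<lambda>(u, v). u @ v) ` ({w. f w \<noteq> 0} \<times> {w. g w \<noteq> 0})"
      by (intro image_eqI[of _ _ "(take i w, drop i w)"]) auto
  qed
  with assms show ?thesis
    by (auto simp: free_alg_simps intro: finite_subset)
qed

lemma ring_free_alg: "ring (free_alg :: 'k::field fa ring)"
proof (intro ringI abelian_groupI monoidI)
  fix x :: "'k fa" assume "x \<in> carrier free_alg"
  then have "(\<lambda>w. - x w) \<in> carrier free_alg"
    using fa_scale_closed[of x "-1"] by simp
  then show "\<exists>y\<in>carrier free_alg. y \<oplus>\<^bsub>free_alg\<^esub> x = \<zero>\<^bsub>free_alg\<^esub>"
    by (intro bexI[of _ "\<lambda>w. - x w"]) (simp_all add: free_alg_simps(4,5))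
qed (use fa_word_closed fa_add_closed fa_mult_closed in
      \<open>auto simp: free_alg_simps fa_mult_linear fa_mult_assoc fa_mult_word_Nil_left
         fa_mult_word_Nil_right add_ac\<close>)

interpretation FA: ring "free_alg :: 'k::field fa ring"
  by (rule ring_free_alg)

lemma free_alg_minus:
  assumes "f \<in> carrier free_alg" "g \<in> carrier free_alg"
  shows "f \<ominus>\<^bsub>free_alg\<^esub> g = (\<lambda>w. f w - g w)"
proof -
  have "\<ominus>\<^bsub>free_alg\<^esub> g = (\<lambda>w. - g w)"
    using assms fa_scale_closed[of g "-1"]
    by (intro FA.minus_equality) (simp_all add: free_alg_simps)
  then show ?thesis by (simp add: a_minus_def free_alg_simps)
qed

text \<open>Induction on the support, removing one word at a time. It is the principle of linear
  extension: linear statements need checking on words only.\<close>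

lemma fa_induct [consumes 1, case_names zero add]:
  fixes f :: "'k::field fa"
  assumes "f \<in> carrier free_alg"
    and "P (\<lambda>u. 0)"
    and "\<And>f a w. f \<in> carrier free_alg \<Longrightarrow> P f \<Longrightarrow> P (\<lambda>u. f u + a * fa_word w u)"
  shows "P f"
proof -
  have "finite S \<Longrightarrow> {w. f w \<noteq> 0} = S \<Longrightarrow> P f" for S and f :: "'k fa"
  proof (induction S arbitrary: f rule: finite_induct)
    case empty
    then have "f = (\<lambda>u. 0)" by auto
    then show ?case using assms(2) by simp
  next
    case (insert w S)
    let ?g = "\<lambda>u. f u - f w * fa_word w u"
    have "{u. ?g u \<noteq> 0} = S"
      using insert by (auto simp: fa_word_def)
    then have "P ?g" "?g \<in> carrier free_alg"
      using insert by (auto simp: free_alg_simps)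
    then have "P (\<lambda>u. ?g u + f w * fa_word w u)"
      using assms(3) by blast
    then show ?case by simp
  qed
  then show ?thesis using assms(1) by (auto simp: free_alg_simps)
qed

section \<open>The defining relations, their ideals and the quotient algebras\<close>

lemma rel_Xp_eq: "rel_Xp = (\<lambda>w. fa_word [GH, GXp] w - fa_word [GXp, GH] w - 2 * fa_word [GXp] w)"
  and rel_Xm_eq: "rel_Xm = (\<lambda>w. fa_word [GH, GXm] w - fa_word [GXm, GH] w + 2 * fa_word [GXm] w)"
  and rel_sl2_eq: "rel_sl2 = (\<lambda>w. fa_word [GXp, GXm] w - fa_word [GXm, GXp] w - fa_word [GH] w)"
  by (simp_all add: rel_Xp_def rel_Xm_def rel_sl2_def fa_comm_def fa_gen_eq_word fa_mult_word_word)

lemma rel_closed: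
  "rel_Xp \<in> carrier free_alg" "rel_Xm \<in> carrier free_alg" "rel_sl2 \<in> carrier free_alg"
  unfolding rel_Xp_eq rel_Xm_eq rel_sl2_eq
  by (intro fa_diff_closed fa_add_closed fa_scale_closed fa_word_closed)+

lemma ideal_Ia: "ideal Ia free_alg"
  unfolding Ia_def using rel_closed by (intro FA.genideal_ideal) auto

lemma ideal_Isl2: "ideal Isl2 free_alg"
  unfolding Isl2_def using rel_closed by (intro FA.genideal_ideal) auto

lemma rel_in_Ia: "rel_Xp \<in> Ia" "rel_Xm \<in> Ia"
  unfolding Ia_def using FA.genideal_self[of "{rel_Xp, rel_Xm}"] rel_closed by auto

lemma rel_in_Isl2: "rel_Xp \<in> Isl2" "rel_Xm \<in> Isl2" "rel_sl2 \<in> Isl2"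
  unfolding Isl2_def using FA.genideal_self[of "{rel_Xp, rel_Xm, rel_sl2}"] rel_closed by auto

lemma Ia_subset_Isl2: "Ia \<subseteq> Isl2"
  unfolding Ia_def using rel_in_Isl2 by (intro FA.genideal_minimal ideal_Isl2) auto

interpretation Ua: ring "Ua :: 'k::field fa set ring"
  unfolding Ua_def by (rule ideal.quotient_is_ring[OF ideal_Ia])

interpretation Usl2: ring "Usl2 :: 'k::field fa set ring"
  unfolding Usl2_def by (rule ideal.quotient_is_ring[OF ideal_Isl2])

lemma ring_hom_cls: "cls \<in> ring_hom free_alg Ua"
  unfolding Ua_def using ideal.rcos_ring_hom[OF ideal_Ia] by (simp add: cls_def[abs_def])

lemma cls_closed: "f \<in> carrier free_alg \<Longrightarrow> cls f \<in> carrier Ua"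
  and cls_mult: "f \<in> carrier free_alg \<Longrightarrow> g \<in> carrier free_alg \<Longrightarrow>
    cls f \<otimes>\<^bsub>Ua\<^esub> cls g = cls (fa_mult f g)"
  and cls_add: "f \<in> carrier free_alg \<Longrightarrow> g \<in> carrier free_alg \<Longrightarrow>
    cls f \<oplus>\<^bsub>Ua\<^esub> cls g = cls (\<lambda>w. f w + g w)"
  and cls_one: "\<one>\<^bsub>Ua\<^esub> = cls (fa_word [])"
  by (simp_all add: ring_hom_closed[OF ring_hom_cls] free_alg_simps(2,3,5)
      ring_hom_mult[OF ring_hom_cls, symmetric] ring_hom_add[OF ring_hom_cls, symmetric]
      ring_hom_one[OF ring_hom_cls, symmetric])

lemma cls_zero: "\<zero>\<^bsub>Ua\<^esub> = cls (\<lambda>w. 0)"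
  by (simp add: ring_hom_zero[OF ring_hom_cls FA.ring_axioms Ua.ring_axioms, symmetric] free_alg_simps(4))

lemma carrier_Ua_cases:
  assumes "C \<in> carrier Ua"
  obtains f where "f \<in> carrier free_alg" "C = cls f"
  using assms by (auto simp: Ua_def FactRing_def A_RCOSETS_def' cls_def)

lemma cls_eq_iff:
  assumes "f \<in> carrier free_alg" "g \<in> carrier free_alg"
  shows "cls f = cls g \<longleftrightarrow> (\<lambda>w. f w - g w) \<in> Ia"
  using FA.quotient_eq_iff_same_a_r_cos[OF ideal_Ia assms] assms by (simp add: cls_def free_alg_minus)

lemma cls_diff:
  assumes "f \<in> carrier free_alg" "g \<in> carrier free_alg"
  shows "cls f \<ominus>\<^bsub>Ua\<^esub> cls g = cls (\<lambda>w. f w - g w)"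
proof -
  have "cls (\<lambda>w. f w - g w) \<oplus>\<^bsub>Ua\<^esub> cls g = cls f"
    using assms by (simp add: cls_add fa_diff_closed)
  then show ?thesis
    using assms Ua.add.inv_solve_right'[of "cls (\<lambda>w. f w - g w)" "cls f" "cls g"]
    by (simp add: a_minus_def cls_closed fa_diff_closed)
qed

section \<open>Formal series over a ring\<close>

lemma pseries_simps:
  "f \<in> carrier (pseries R) \<longleftrightarrow> (\<forall>n. f n \<in> carrier R)"
  "(f \<otimes>\<^bsub>pseries R\<^esub> g) n = finsum R (\<lambda>i. f i \<otimes>\<^bsub>R\<^esub> g (n - i)) {..n}"
  "\<one>\<^bsub>pseries R\<^esub> n = (if n = 0 then \<one>\<^bsub>R\<^esub> else \<zero>\<^bsub>R\<^esub>)"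
  "\<zero>\<^bsub>pseries R\<^esub> n = \<zero>\<^bsub>R\<^esub>"
  "(f \<oplus>\<^bsub>pseries R\<^esub> g) n = f n \<oplus>\<^bsub>R\<^esub> g n"
  by (simp_all add: pseries_def)

text \<open>Associativity only involves finitely many coefficients at a time, so it is inherited from
  the polynomial ring by truncation.\<close>

lemma (in ring) pseries_mult_assoc:
  assumes f: "f \<in> carrier (pseries R)" and g: "g \<in> carrier (pseries R)" and h: "h \<in> carrier (pseries R)"
  shows "(f \<otimes>\<^bsub>pseries R\<^esub> g) \<otimes>\<^bsub>pseries R\<^esub> h = f \<otimes>\<^bsub>pseries R\<^esub> (g \<otimes>\<^bsub>pseries R\<^esub> h)"
proof
  fix n
  define T where "T x = (\<lambda>i. if i \<le> n then x i else \<zero>)" for x :: "nat \<Rightarrow> 'a"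
  have Tn: "T x i = x i" if "i \<le> n" for x i using that by (simp add: T_def)
  have T: "T x \<in> carrier (UP R)" if "x \<in> carrier (pseries R)" for x
    using that unfolding UP_def T_def
    by (auto simp: pseries_simps intro!: mem_upI exI[of _ n] bound.intro)
  have assoc: "(x \<otimes>\<^bsub>UP R\<^esub> y) \<otimes>\<^bsub>UP R\<^esub> z = x \<otimes>\<^bsub>UP R\<^esub> (y \<otimes>\<^bsub>UP R\<^esub> z)"
    and closed: "x \<otimes>\<^bsub>UP R\<^esub> y \<in> carrier (UP R)"
    if "x \<in> carrier (UP R)" "y \<in> carrier (UP R)" "z \<in> carrier (UP R)" for x y z
    using that UP_ring.UP_m_assoc[of R] UP_ring.UP_mult_closed[of R] ring_axioms by (auto simp: UP_ring_def)
  have mult: "(x \<otimes>\<^bsub>UP R\<^esub> y) = (\<lambda>m. \<Oplus>i\<in>{..m}. x i \<otimes> y (m - i))"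
    if "x \<in> carrier (UP R)" "y \<in> carrier (UP R)" for x y
    using that by (simp add: UP_def)
  have low: "(T x \<otimes>\<^bsub>UP R\<^esub> T y) m = (x \<otimes>\<^bsub>pseries R\<^esub> y) m"
    if "m \<le> n" "x \<in> carrier (pseries R)" "y \<in> carrier (pseries R)" for x y m
    using that mult[OF T[OF that(2)] T[OF that(3)]]
    by (auto simp: pseries_simps Tn intro!: finsum_cong')
  have "((T f \<otimes>\<^bsub>UP R\<^esub> T g) \<otimes>\<^bsub>UP R\<^esub> T h) n = (T f \<otimes>\<^bsub>UP R\<^esub> (T g \<otimes>\<^bsub>UP R\<^esub> T h)) n"
    by (simp add: T f g h assoc)
  moreover have "((T f \<otimes>\<^bsub>UP R\<^esub> T g) \<otimes>\<^bsub>UP R\<^esub> T h) n = ((f \<otimes>\<^bsub>pseries R\<^esub> g) \<otimes>\<^bsub>pseries R\<^esub> h) n"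
    using f g h mult[OF closed[OF T[OF f] T[OF g] T[OF h]] T[OF h]]
    by (auto simp: low Tn pseries_simps intro!: finsum_cong')
  moreover have "(T f \<otimes>\<^bsub>UP R\<^esub> (T g \<otimes>\<^bsub>UP R\<^esub> T h)) n = (f \<otimes>\<^bsub>pseries R\<^esub> (g \<otimes>\<^bsub>pseries R\<^esub> h)) n"
    using f g h mult[OF T[OF f] closed[OF T[OF g] T[OF h] T[OF f]]]
    by (auto simp: low Tn pseries_simps intro!: finsum_cong')
  ultimately show "((f \<otimes>\<^bsub>pseries R\<^esub> g) \<otimes>\<^bsub>pseries R\<^esub> h) n = (f \<otimes>\<^bsub>pseries R\<^esub> (g \<otimes>\<^bsub>pseries R\<^esub> h)) n"
    by simp
qed

text \<open>Serves the unit laws, multiplication by \<open>fps_X\<close> and constant terms, where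
  the Cauchy sum has one surviving term.\<close>

lemma (in ring) pseries_mult_single:
  assumes "f \<in> carrier (pseries R)" "g \<in> carrier (pseries R)"
    and "\<And>i. i \<le> n \<Longrightarrow> i \<noteq> j \<Longrightarrow> f i = \<zero> \<or> g (n - i) = \<zero>" and "j \<le> n"
  shows "(f \<otimes>\<^bsub>pseries R\<^esub> g) n = f j \<otimes> g (n - j)"
proof -
  have "(f \<otimes>\<^bsub>pseries R\<^esub> g) n = (\<Oplus>i\<in>{..n}. if j = i then f i \<otimes> g (n - i) else \<zero>)"
    unfolding pseries_simps(2) using assms
    by (intro finsum_cong') (auto simp: pseries_simps, metis r_null l_null)
  also have "\<dots> = f j \<otimes> g (n - j)"
    using assms by (intro finsum_singleton) (auto simp: pseries_simps)
  finally show ?thesis .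
qed

lemma (in ring) ring_pseries: "ring (pseries R)"
proof (intro ringI abelian_groupI monoidI)
  fix x assume "x \<in> carrier (pseries R)"
  then show "\<exists>y\<in>carrier (pseries R). y \<oplus>\<^bsub>pseries R\<^esub> x = \<zero>\<^bsub>pseries R\<^esub>"
    by (intro bexI[of _ "\<lambda>n. \<ominus> x n"]) (auto simp: pseries_simps l_neg)
next
  fix x assume x: "x \<in> carrier (pseries R)"
  have one: "\<one>\<^bsub>pseries R\<^esub> \<in> carrier (pseries R)" by (simp add: pseries_simps)
  show "\<one>\<^bsub>pseries R\<^esub> \<otimes>\<^bsub>pseries R\<^esub> x = x"
  proof
    show "(\<one>\<^bsub>pseries R\<^esub> \<otimes>\<^bsub>pseries R\<^esub> x) n = x n" for n
      using x one by (subst pseries_mult_single[where j = 0]) (auto simp: pseries_simps)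
  qed
  show "x \<otimes>\<^bsub>pseries R\<^esub> \<one>\<^bsub>pseries R\<^esub> = x"
  proof
    show "(x \<otimes>\<^bsub>pseries R\<^esub> \<one>\<^bsub>pseries R\<^esub>) n = x n" for n
      using x one by (subst pseries_mult_single[where j = n]) (auto simp: pseries_simps)
  qed
next
  fix x y z assume "x \<in> carrier (pseries R)" "y \<in> carrier (pseries R)" "z \<in> carrier (pseries R)"
  note xyz = this
  then show "(x \<oplus>\<^bsub>pseries R\<^esub> y) \<otimes>\<^bsub>pseries R\<^esub> z = x \<otimes>\<^bsub>pseries R\<^esub> z \<oplus>\<^bsub>pseries R\<^esub> y \<otimes>\<^bsub>pseries R\<^esub> z"
    by (intro ext) (auto simp: pseries_simps l_distr finsum_addf Pi_def)
  show "z \<otimes>\<^bsub>pseries R\<^esub> (x \<oplus>\<^bsub>pseries R\<^esub> y) = z \<otimes>\<^bsub>pseries R\<^esub> x \<oplus>\<^bsub>pseries R\<^esub> z \<otimes>\<^bsub>pseries R\<^esub> y"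
    using xyz by (intro ext) (auto simp: pseries_simps r_distr finsum_addf Pi_def)
qed (auto simp: pseries_simps pseries_mult_assoc a_ac fun_eq_iff)

lemma (in ring) pseries_minus:
  assumes "f \<in> carrier (pseries R)" "g \<in> carrier (pseries R)"
  shows "(f \<ominus>\<^bsub>pseries R\<^esub> g) n = f n \<ominus> g n"
proof -
  interpret P: ring "pseries R" by (rule ring_pseries)
  have "\<ominus>\<^bsub>pseries R\<^esub> g = (\<lambda>n. \<ominus> g n)"
    using assms by (intro P.minus_equality) (auto simp: pseries_simps l_neg fun_eq_iff)
  then show ?thesis by (simp add: a_minus_def pseries_simps)
qed

interpretation Uha: ring "Uha :: (nat \<Rightarrow> 'k::field fa set) ring"
  unfolding Uha_def by (rule Ua.ring_pseries)

lemmas Uha_simps = pseries_simps[where R = Ua, folded Uha_def]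
lemmas Uha_minus = Ua.pseries_minus[folded Uha_def]
lemmas Uha_mult_single = Ua.pseries_mult_single[folded Uha_def]

text \<open>Representatives of all coefficients are chosen simultaneously, so that computations in
  \<open>Uha\<close> can be carried out in the free algebra.\<close>

lemma carrier_Uha_ex_cls:
  assumes "x \<in> carrier Uha"
  shows "\<exists>f. (\<forall>n. f n \<in> carrier free_alg) \<and> x = (\<lambda>n. cls (f n))"
proof -
  have "\<exists>f. f \<in> carrier free_alg \<and> x n = cls f" for n
  proof -
    have "x n \<in> carrier Ua" using assms by (simp add: Uha_simps)
    then show ?thesis by (rule carrier_Ua_cases) blast
  qed
  then have "\<exists>f. \<forall>n. f n \<in> carrier free_alg \<and> x n = cls (f n)" by (intro choice allI)
  then show ?thesis by (auto simp: fun_eq_iff)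
qed

lemma cls_in_Uha: "(\<And>n. f n \<in> carrier free_alg) \<Longrightarrow> (\<lambda>n. cls (f n)) \<in> carrier Uha"
  by (simp add: Uha_simps cls_closed)

lemma fa_sum_closed:
  assumes "finite S" "\<And>i. i \<in> S \<Longrightarrow> f i \<in> carrier free_alg"
  shows "(\<lambda>w. \<Sum>i\<in>S. f i w) \<in> carrier free_alg"
  using assms
proof (induction S rule: finite_induct)
  case empty
  then show ?case by (simp add: free_alg_simps)
next
  case (insert i S)
  then show ?case by (simp add: fa_add_closed)
qed

lemma finsum_cls:
  assumes "finite S" "\<And>i. i \<in> S \<Longrightarrow> f i \<in> carrier free_alg"
  shows "finsum Ua (\<lambda>i. cls (f i)) S = cls (\<lambda>w. \<Sum>i\<in>S. f i w)"
  using assms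
proof (induction S rule: finite_induct)
  case empty
  then show ?case by (simp add: cls_zero)
next
  case (insert i S)
  then show ?case
    by (subst Ua.finsum_insert) (auto simp: cls_closed cls_add fa_sum_closed)
qed

lemma Uha_mult_cls:
  assumes "\<And>n. f n \<in> carrier free_alg" "\<And>n. g n \<in> carrier free_alg"
  shows "(\<lambda>n. cls (f n)) \<otimes>\<^bsub>Uha\<^esub> (\<lambda>n. cls (g n)) = (\<lambda>n. cls (\<lambda>w. \<Sum>i\<le>n. fa_mult (f i) (g (n - i)) w))"
  using assms by (auto simp: fun_eq_iff Uha_simps cls_mult finsum_cls fa_mult_closed)

section \<open>The action on the modules \<open>V\<^sub>h(n, \<psi>)\<close>\<close>

text \<open>The series \<open>\<Sum>m. h^m s_m\<close>.\<close>

definition hsum :: "(nat \<Rightarrow> 'k::field fps) \<Rightarrow> 'k fps" where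
  "hsum s = Abs_fps (\<lambda>d. \<Sum>m\<le>d. fps_nth (s m) (d - m))"

text \<open>The term \<open>fps_X ^ m * s m\<close> has no coefficient below degree
  \<open>m\<close>, so up to a fixed degree the infinite series is a finite sum.\<close>

lemma hsum_nth_partial:
  assumes "d \<le> D"
  shows "fps_nth (hsum s) d = fps_nth (\<Sum>m\<le>D. fps_X ^ m * s m) d"
proof -
  have "fps_nth (\<Sum>m\<le>D. fps_X ^ m * s m) d = (\<Sum>m\<le>D. if m \<le> d then fps_nth (s m) (d - m) else 0)"
    by (auto simp: fps_sum_nth fps_X_power_mult_nth intro!: sum.cong)
  also have "\<dots> = (\<Sum>m\<le>d. fps_nth (s m) (d - m))"
    using assms by (intro sum.mono_neutral_cong_right) auto
  finally show ?thesis by (simp add: hsum_def)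
qed

lemma hsum_mult: "hsum (\<lambda>m. p * s m) = p * hsum s"
proof (rule fps_ext)
  fix d
  \<comment> \<open>Degree \<open>d\<close> of a product involves only degrees up to
    \<open>d\<close> of its factors, where \<open>hsum s\<close> may be truncated.\<close>
  have "fps_nth (p * hsum s) d = fps_nth (p * (\<Sum>m\<le>d. fps_X ^ m * s m)) d"
    unfolding fps_mult_nth by (intro sum.cong refl arg_cong2[of _ _ _ _ "(*)"] hsum_nth_partial) auto
  also have "\<dots> = fps_nth (hsum (\<lambda>m. p * s m)) d"
    by (simp add: hsum_nth_partial[of d d] sum_distrib_left mult.left_commute)
  finally show "fps_nth (hsum (\<lambda>m. p * s m)) d = fps_nth (p * hsum s) d" ..
qed

lemma hsum_zero: "hsum (\<lambda>m. 0) = 0"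
  by (rule fps_ext) (simp add: hsum_def)

lemma hsum_sum: "hsum (\<lambda>m. \<Sum>i\<in>S. s i m) = (\<Sum>i\<in>S. hsum (s i))"
  by (rule fps_ext) (simp add: hsum_def fps_sum_nth sum.swap[of _ S])

lemma hsum_add: "hsum (\<lambda>m. s m + t m) = hsum s + hsum t"
  by (rule fps_ext) (simp add: hsum_def sum.distrib)

lemma hsum_diff: "hsum (\<lambda>m. s m - t m) = hsum s - hsum t"
  by (rule fps_ext) (simp add: hsum_def sum_subtractf)

text \<open>Both sides collect the terms \<open>s i j\<close> by the total power
  \<open>i + j\<close> of h. The right side has the shape of a Cauchy product, which makes the
  action of series multiplicative.\<close>

lemma hsum_hsum: "hsum (\<lambda>i. hsum (s i)) = hsum (\<lambda>m. \<Sum>i\<le>m. s i (m - i))"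
proof (rule fps_ext)
  fix d
  have "fps_nth (hsum (\<lambda>i. hsum (s i))) d
      = (\<Sum>(i, j)\<in>(SIGMA i:{..d}. {..d - i}). fps_nth (s i j) (d - (i + j)))"
    by (simp add: hsum_def sum.Sigma)
  also have "(SIGMA i:{..d}. {..d - i}) = {(i, j). i + j \<le> d}" by auto
  also have "(\<Sum>(i, j)\<in>\<dots>. fps_nth (s i j) (d - (i + j))) = (\<Sum>m\<le>d. \<Sum>i\<le>m. fps_nth (s i (m - i)) (d - m))"
    by (subst sum.triangle_reindex_eq) (auto intro!: sum.cong)
  finally show "fps_nth (hsum (\<lambda>i. hsum (s i))) d = fps_nth (hsum (\<lambda>m. \<Sum>i\<le>m. s i (m - i))) d"
    by (simp add: hsum_def fps_sum_nth)
qed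

text \<open>A power series is the sum of its own terms; the common factor \<open>v\<close> is then
  pulled out by \<open>hsum_mult\<close>.\<close>

lemma hsum_scalars: "hsum (\<lambda>m. fps_const (fps_nth p m) * v) = p * v"
proof -
  have "hsum (\<lambda>m. fps_const (fps_nth p m)) = p"
  proof (rule fps_ext)
    fix d
    have "(\<Sum>m\<le>d. fps_nth (fps_const (fps_nth p m)) (d - m)) = (\<Sum>m\<le>d. if m = d then fps_nth p m else 0)"
      by (intro sum.cong) auto
    then show "fps_nth (hsum (\<lambda>m. fps_const (fps_nth p m))) d = fps_nth p d"
      by (simp add: hsum_def)
  qed
  then show ?thesis using hsum_mult[of v "\<lambda>m. fps_const (fps_nth p m)"] by (simp add: mult.commute)
qed

section \<open>Action of words and of free algebra elements on coordinate vectors\<close>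

lemma gen_act_hsum: "gen_act psi n g (\<lambda>k. hsum (\<lambda>m. v m k)) = (\<lambda>k. hsum (\<lambda>m. gen_act psi n g (v m) k))"
  by (cases g) (auto simp: gen_act_def hsum_mult hsum_zero fun_eq_iff)

lemma gen_act_add: "gen_act psi n g (\<lambda>k. u k + v k) = (\<lambda>k. gen_act psi n g u k + gen_act psi n g v k)"
  and gen_act_scale: "gen_act psi n g (\<lambda>k. p * v k) = (\<lambda>k. p * gen_act psi n g v k)"
  and gen_act_zero: "gen_act psi n g (\<lambda>k. 0) = (\<lambda>k. 0)"
  by (cases g; auto simp: gen_act_def fun_eq_iff algebra_simps)+

lemma word_act_Nil: "word_act psi n [] c = c"
  and word_act_Cons: "word_act psi n (g # w) c = gen_act psi n g (word_act psi n w c)"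
  and word_act_append: "word_act psi n (u @ w) c = word_act psi n u (word_act psi n w c)"
  by (simp_all add: word_act_def)

lemma word_act_hsum: "word_act psi n w (\<lambda>k. hsum (\<lambda>m. v m k)) = (\<lambda>k. hsum (\<lambda>m. word_act psi n w (v m) k))"
  by (induction w) (simp_all add: word_act_Nil word_act_Cons gen_act_hsum)

lemma word_act_add: "word_act psi n w (\<lambda>k. u k + v k) = (\<lambda>k. word_act psi n w u k + word_act psi n w v k)"
  and word_act_scale: "word_act psi n w (\<lambda>k. p * v k) = (\<lambda>k. p * word_act psi n w v k)"
  and word_act_zero: "word_act psi n w (\<lambda>k. 0) = (\<lambda>k. 0)"
  by (induction w) (simp_all add: word_act_Nil word_act_Cons gen_act_add gen_act_scale gen_act_zero)

text \<open>The support of a sum or multiple differs from the supports of its ingredients; over a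
  common finite superset the sums can be compared term by term.\<close>

lemma fa_act_superset:
  assumes "finite S" "{w. f w \<noteq> 0} \<subseteq> S"
  shows "fa_act psi n f c k = (\<Sum>w\<in>S. fps_const (f w) * word_act psi n w c k)"
  unfolding fa_act_def using assms by (intro sum.mono_neutral_left) auto

lemma fa_act_word: "fa_act psi n (fa_word w) c = word_act psi n w c"
  by (rule ext, subst fa_act_superset[of "{w}"]) (auto simp: fa_word_def)

lemma fa_act_zero: "fa_act psi n (\<lambda>w. 0) c = (\<lambda>k. 0)"
  by (simp add: fa_act_def)

lemma fa_act_add:
  assumes "f \<in> carrier free_alg" "g \<in> carrier free_alg"
  shows "fa_act psi n (\<lambda>w. f w + g w) c = (\<lambda>k. fa_act psi n f c k + fa_act psi n g c k)"
proof
  fix k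
  let ?S = "{w. f w \<noteq> 0} \<union> {w. g w \<noteq> 0}"
  have "finite ?S" using assms by (simp add: free_alg_simps)
  then show "fa_act psi n (\<lambda>w. f w + g w) c k = fa_act psi n f c k + fa_act psi n g c k"
    by (subst (1 2 3) fa_act_superset[of ?S])
       (auto simp: sum.distrib[symmetric] distrib_right[symmetric] intro!: sum.cong)
qed

lemma fa_act_scale:
  assumes "f \<in> carrier free_alg"
  shows "fa_act psi n (\<lambda>w. a * f w) c = (\<lambda>k. fps_const a * fa_act psi n f c k)"
proof
  fix k
  let ?S = "{w. f w \<noteq> 0}"
  have "finite ?S" using assms by (simp add: free_alg_simps)
  then show "fa_act psi n (\<lambda>w. a * f w) c k = fps_const a * fa_act psi n f c k"
    by (subst (1 2) fa_act_superset[of ?S])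
       (auto simp: sum_distrib_left mult.assoc fps_const_mult[symmetric] simp del: fps_const_mult intro!: sum.cong)
qed

lemma fa_act_diff:
  assumes "f \<in> carrier free_alg" "g \<in> carrier free_alg"
  shows "fa_act psi n (\<lambda>w. f w - g w) c = (\<lambda>k. fa_act psi n f c k - fa_act psi n g c k)"
  using fa_act_add[OF assms(1) fa_scale_closed[OF assms(2), of "-1"]]
  by (simp add: fa_act_scale[OF assms(2), of _ _ "-1", simplified] fps_const_neg[symmetric] del: fps_const_neg)

lemma fa_act_sum:
  assumes "finite S" "\<And>i. i \<in> S \<Longrightarrow> f i \<in> carrier free_alg"
  shows "fa_act psi n (\<lambda>w. \<Sum>i\<in>S. f i w) c = (\<lambda>k. \<Sum>i\<in>S. fa_act psi n (f i) c k)"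
  using assms
  by (induction S rule: finite_induct) (simp_all add: fa_act_zero fa_act_add fa_sum_closed)

lemma fa_act_vec_zero: "fa_act psi n f (\<lambda>k. 0) = (\<lambda>k. 0)"
  by (simp add: fa_act_def word_act_zero)

lemma fa_act_hsum: "fa_act psi n f (\<lambda>k. hsum (\<lambda>m. v m k)) = (\<lambda>k. hsum (\<lambda>m. fa_act psi n f (v m) k))"
  by (simp add: fa_act_def word_act_hsum hsum_sum hsum_mult)

text \<open>Half of the reduction of \<open>fa_act_mult\<close> to words: linearity in the right
  factor comes here, linearity in the left factor next. On words the claim is
  \<open>word_act_append\<close>.\<close>

lemma fa_act_word_mult:
  assumes "g \<in> carrier free_alg"
  shows "fa_act psi n (fa_mult (fa_word u) g) c = word_act psi n u (fa_act psi n g c)"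
  using assms
proof (induction g rule: fa_induct)
  case zero
  then show ?case by (simp add: fa_mult_linear fa_act_zero word_act_zero)
next
  case (add f a w)
  have "fa_mult (fa_word u) (\<lambda>x. f x + a * fa_word w x) = (\<lambda>x. fa_mult (fa_word u) f x + a * fa_word (u @ w) x)"
    by (simp add: fun_eq_iff fa_mult_linear fa_mult_word_word)
  with add show ?case
    by (simp add: fa_act_add fa_act_scale fa_mult_closed fa_word_closed fa_scale_closed fa_act_word
        word_act_add word_act_scale word_act_append)
qed

lemma fa_act_mult:
  assumes "f \<in> carrier free_alg" "g \<in> carrier free_alg"
  shows "fa_act psi n (fa_mult f g) c = fa_act psi n f (fa_act psi n g c)"
  using assms(1)
proof (induction f rule: fa_induct)
  case zero
  then show ?case by (simp add: fa_mult_linear fa_act_zero)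
next
  case (add f a w)
  have "fa_mult (\<lambda>x. f x + a * fa_word w x) g = (\<lambda>x. fa_mult f g x + a * fa_mult (fa_word w) g x)"
    by (simp add: fun_eq_iff fa_mult_linear)
  with add assms(2) show ?case
    by (simp add: fa_act_add fa_act_scale fa_mult_closed fa_word_closed fa_scale_closed fa_act_word
        fa_act_word_mult)
qed

text \<open>All coordinate functions \<open>c\<close> are tested, not only those in
  \<open>Vh\<close>; closure under right multiplication then follows at once from
  \<open>fa_act_mult\<close>.\<close>

definition fa_ann :: "(nat \<Rightarrow> int \<Rightarrow> 'k::field fps) \<Rightarrow> 'k fa set" where
  "fa_ann psi = {f \<in> carrier free_alg. \<forall>n c. fa_act psi n f c = (\<lambda>k. 0)}"

lemma ideal_fa_ann: "ideal (fa_ann psi) free_alg"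
proof (rule idealI[OF FA.ring_axioms])
  show "subgroup (fa_ann psi) (add_monoid free_alg)"
  proof (rule FA.add.subgroupI)
    fix a assume a: "a \<in> fa_ann psi"
    then have "\<ominus>\<^bsub>free_alg\<^esub> a = (\<lambda>w. - 1 * a w)"
      using fa_scale_closed[of a "-1"]
      by (intro FA.minus_equality) (auto simp: free_alg_simps fa_ann_def)
    with a show "\<ominus>\<^bsub>free_alg\<^esub> a \<in> fa_ann psi"
      by (simp only: fa_ann_def mem_Collect_eq fa_scale_closed fa_act_scale) auto
  next
    have "(\<lambda>w. 0) \<in> fa_ann psi" using FA.zero_closed by (simp add: fa_ann_def fa_act_zero free_alg_simps)
    then show "fa_ann psi \<noteq> {}" by auto
  qed (auto simp: fa_ann_def fa_act_add fa_add_closed free_alg_simps(5))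
qed (auto simp: fa_ann_def fa_act_mult fa_mult_closed free_alg_simps(2) fa_act_vec_zero)

text \<open>For every \<open>psi\<close>, \<open>GH\<close> is diagonal with weights
  \<open>n - 2 * k\<close>, while \<open>GXp\<close> and \<open>GXm\<close> shift the index by one
  and hence the weight by two.\<close>

lemma rel_in_fa_ann: "rel_Xp \<in> fa_ann psi" "rel_Xm \<in> fa_ann psi"
proof -
  have "fa_act psi n rel_Xp c k = 0" for n c k
    by (simp add: rel_Xp_eq fa_act_diff fa_act_scale fa_diff_closed fa_scale_closed fa_word_closed
        fa_act_word word_act_Cons word_act_Nil gen_act_def) (simp add: numeral_fps_const[symmetric] algebra_simps)
  moreover have "fa_act psi n rel_Xm c k = 0" for n c k
    by (simp add: rel_Xm_eq fa_act_add fa_act_diff fa_act_scale fa_diff_closed fa_scale_closed fa_word_closed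
        fa_act_word word_act_Cons word_act_Nil gen_act_def of_nat_diff) (simp add: numeral_fps_const[symmetric] algebra_simps)
  ultimately show "rel_Xp \<in> fa_ann psi" "rel_Xm \<in> fa_ann psi"
    by (auto simp: fa_ann_def rel_closed)
qed

text \<open>This is what makes the action of the free algebra descend to \<open>Ua\<close>.\<close>

lemma Ia_subset_fa_ann: "Ia \<subseteq> fa_ann psi"
  unfolding Ia_def using rel_in_fa_ann by (intro FA.genideal_minimal ideal_fa_ann) auto

lemma cls_self: "f \<in> carrier free_alg \<Longrightarrow> f \<in> cls f"
  using additive_subgroup.zero_closed[OF ideal.axioms(1)[OF ideal_Ia]]
  unfolding cls_def a_r_coset_def' by (auto intro!: bexI[of _ "\<zero>\<^bsub>free_alg\<^esub>"])

text \<open>The representative picked by \<open>SOME\<close> in \<open>Ua_act\<close> differs from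
  \<open>f\<close> by an element of \<open>Ia\<close>, which acts by zero.\<close>

lemma Ua_act_cls:
  assumes "f \<in> carrier free_alg"
  shows "Ua_act psi n (cls f) c = fa_act psi n f c"
proof -
  define g where "g = (SOME g. g \<in> cls f)"
  have "f \<in> cls f" using assms by (rule cls_self)
  then have "g \<in> cls f" unfolding g_def by (rule someI[of "\<lambda>g. g \<in> cls f"])
  then obtain i where i: "i \<in> Ia" "g = (\<lambda>w. i w + f w)"
    by (auto simp: cls_def a_r_coset_def' free_alg_simps)
  moreover have "i \<in> fa_ann psi" using i Ia_subset_fa_ann by blast
  ultimately have "fa_act psi n g c = fa_act psi n f c"
    using assms by (simp add: fa_ann_def fa_act_add)
  then show ?thesis by (simp add: Ua_act_def g_def)
qed

lemma Uha_act_cls: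
  assumes "\<And>m. f m \<in> carrier free_alg"
  shows "Uha_act psi n (\<lambda>m. cls (f m)) c = (\<lambda>k. hsum (\<lambda>m. fa_act psi n (f m) c k))"
  using assms by (simp add: Uha_act_def hsum_def Ua_act_cls)

text \<open>\<open>fa_act_hsum\<close> moves the outer action inside the inner series, and
  \<open>hsum_hsum\<close> regroups the double series into the Cauchy product.\<close>

lemma Uha_act_mult:
  assumes "x \<in> carrier Uha" "y \<in> carrier Uha"
  shows "Uha_act psi n (x \<otimes>\<^bsub>Uha\<^esub> y) c = Uha_act psi n x (Uha_act psi n y c)"
proof -
  obtain f where f: "\<And>m. f m \<in> carrier free_alg" "x = (\<lambda>m. cls (f m))"
    using carrier_Uha_ex_cls[OF assms(1)] by blast
  obtain g where g: "\<And>m. g m \<in> carrier free_alg" "y = (\<lambda>m. cls (g m))"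
    using carrier_Uha_ex_cls[OF assms(2)] by blast
  show ?thesis
    unfolding f(2) g(2)
    by (simp add: Uha_mult_cls Uha_act_cls f g fa_sum_closed fa_mult_closed fa_act_sum fa_act_mult
        fa_act_hsum hsum_hsum)
qed

lemma Uha_act_add:
  assumes "x \<in> carrier Uha" "y \<in> carrier Uha"
  shows "Uha_act psi n (x \<oplus>\<^bsub>Uha\<^esub> y) c = (\<lambda>k. Uha_act psi n x c k + Uha_act psi n y c k)"
proof -
  obtain f where f: "\<And>m. f m \<in> carrier free_alg" "x = (\<lambda>m. cls (f m))"
    using carrier_Uha_ex_cls[OF assms(1)] by blast
  obtain g where g: "\<And>m. g m \<in> carrier free_alg" "y = (\<lambda>m. cls (g m))"
    using carrier_Uha_ex_cls[OF assms(2)] by blast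
  have "x \<oplus>\<^bsub>Uha\<^esub> y = (\<lambda>m. cls (\<lambda>w. f m w + g m w))"
    by (simp add: fun_eq_iff Uha_simps f g cls_add)
  then show ?thesis
    by (simp add: f(2) g(2) Uha_act_cls f(1) g(1) fa_act_add fa_add_closed hsum_add)
qed

lemma Uha_act_minus:
  assumes "x \<in> carrier Uha" "y \<in> carrier Uha"
  shows "Uha_act psi n (x \<ominus>\<^bsub>Uha\<^esub> y) c = (\<lambda>k. Uha_act psi n x c k - Uha_act psi n y c k)"
proof -
  obtain f where f: "\<And>m. f m \<in> carrier free_alg" "x = (\<lambda>m. cls (f m))"
    using carrier_Uha_ex_cls[OF assms(1)] by blast
  obtain g where g: "\<And>m. g m \<in> carrier free_alg" "y = (\<lambda>m. cls (g m))"
    using carrier_Uha_ex_cls[OF assms(2)] by blast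
  have "x \<ominus>\<^bsub>Uha\<^esub> y = (\<lambda>m. cls (\<lambda>w. f m w - g m w))"
    by (subst fun_eq_iff, subst Uha_minus[OF assms]) (simp add: f g cls_diff)
  then show ?thesis
    by (simp add: f(2) g(2) Uha_act_cls f(1) g(1) fa_act_diff fa_diff_closed hsum_diff)
qed

lemma Uha_act_zero: "Uha_act psi n \<zero>\<^bsub>Uha\<^esub> c = (\<lambda>k. 0)"
  using Uha_act_minus[of "\<zero>\<^bsub>Uha\<^esub>" "\<zero>\<^bsub>Uha\<^esub>" psi n c] by (simp add: Uha.r_neg Uha.minus_eq)

section \<open>Stability of \<open>Vh\<close> and the annihilator ideals\<close>

lemma gen_act_Vh:
  assumes "c \<in> Vh"
  shows "gen_act psi n g c \<in> Vh"
proof -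
  \<comment> \<open>Covers \<open>GH\<close> and \<open>GXp\<close> together: degree
    \<open>m\<close> of a product sees only degrees up to \<open>m\<close> of \<open>c\<close>, and
    preimages of finite sets under the injective reindexing \<open>s\<close> are finite.\<close>
  have fin: "finite {k. fps_nth (p k * c (s k)) m \<noteq> 0}" if "inj_on s {k. c (s k) \<noteq> 0}" for p s m
  proof (rule finite_subset)
    show "{k. fps_nth (p k * c (s k)) m \<noteq> 0} \<subseteq> (\<Union>i\<le>m. {k. fps_nth (c (s k)) i \<noteq> 0})"
      by (auto simp: fps_mult_nth elim!: sum.not_neutral_contains_not_neutral) (use diff_le_self in blast)
    have "finite (s -` {k. fps_nth (c k) i \<noteq> 0} \<inter> {k. c (s k) \<noteq> 0})" for i
      using assms that by (intro finite_vimage_IntI) (auto simp: Vh_def)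
    moreover have "s -` {k. fps_nth (c k) i \<noteq> 0} \<inter> {k. c (s k) \<noteq> 0} = {k. fps_nth (c (s k)) i \<noteq> 0}" for i
      by auto
    ultimately show "finite (\<Union>i\<le>m. {k. fps_nth (c (s k)) i \<noteq> 0})" by simp
  qed
  show ?thesis
  proof (cases g)
    case GH
    then show ?thesis using fin[of id] by (simp add: gen_act_def Vh_def)
  next
    case GXp
    then show ?thesis using fin[of "\<lambda>k. k + 1"] by (simp add: gen_act_def Vh_def inj_on_def)
  next
    case GXm
    have sub: "{k. fps_nth (if k = 0 then 0 else c (k - 1)) m \<noteq> 0} \<subseteq> Suc ` {k. fps_nth (c k) m \<noteq> 0}" for m
    proof
      fix k assume "k \<in> {k. fps_nth (if k = 0 then 0 else c (k - 1)) m \<noteq> 0}"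
      then show "k \<in> Suc ` {k. fps_nth (c k) m \<noteq> 0}" by (cases k) auto
    qed
    then have "finite {k. fps_nth (if k = 0 then 0 else c (k - 1)) m \<noteq> 0}" for m
      using assms by (intro finite_subset[OF sub]) (simp add: Vh_def)
    then show ?thesis using GXm by (simp add: gen_act_def Vh_def)
  qed
qed

lemma word_act_Vh: "c \<in> Vh \<Longrightarrow> word_act psi n w c \<in> Vh"
  by (induction w) (simp_all add: word_act_Nil word_act_Cons gen_act_Vh)

lemma fa_act_Vh:
  assumes "f \<in> carrier free_alg" "c \<in> Vh"
  shows "fa_act psi n f c \<in> Vh"
proof -
  have sub: "{k. fps_nth (fa_act psi n f c k) m \<noteq> 0}
      \<subseteq> (\<Union>w\<in>{w. f w \<noteq> 0}. {k. fps_nth (word_act psi n w c k) m \<noteq> 0})" for m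
    by (auto simp: fa_act_def fps_sum_nth elim!: sum.not_neutral_contains_not_neutral)
  moreover have "finite (\<Union>w\<in>{w. f w \<noteq> 0}. {k. fps_nth (word_act psi n w c k) m \<noteq> 0})" for m
    using assms word_act_Vh[OF assms(2)] by (auto simp: free_alg_simps Vh_def)
  ultimately show ?thesis unfolding Vh_def using finite_subset[OF sub] by simp
qed

lemma Uha_act_Vh:
  assumes "x \<in> carrier Uha" "c \<in> Vh"
  shows "Uha_act psi n x c \<in> Vh"
proof -
  obtain f where f: "\<And>m. f m \<in> carrier free_alg" "x = (\<lambda>m. cls (f m))"
    using carrier_Uha_ex_cls[OF assms(1)] by blast
  have sub: "{k. fps_nth (Uha_act psi n x c k) d \<noteq> 0}
      \<subseteq> (\<Union>m\<le>d. {k. fps_nth (fa_act psi n (f m) c k) (d - m) \<noteq> 0})" for d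
    by (auto simp: f(2) Uha_act_cls[OF f(1)] hsum_def elim!: sum.not_neutral_contains_not_neutral)
  moreover have "finite (\<Union>m\<le>d. {k. fps_nth (fa_act psi n (f m) c k) (d - m) \<noteq> 0})" for d
    using fa_act_Vh[OF f(1) assms(2)] by (auto simp: Vh_def)
  ultimately show ?thesis unfolding Vh_def using finite_subset[OF sub] by simp
qed

lemma ideal_Ann: "ideal (Ann psi) (Uha :: (nat \<Rightarrow> 'k::field fa set) ring)"
proof (rule idealI[OF Uha.ring_axioms])
  show "subgroup (Ann psi) (add_monoid Uha)"
  proof (rule Uha.add.subgroupI)
    fix x assume "x \<in> Ann psi"
    then show "\<ominus>\<^bsub>Uha\<^esub> x \<in> Ann psi"
      using Uha_act_minus[of "\<zero>\<^bsub>Uha\<^esub>" x psi] by (simp add: Ann_def Uha_act_zero Uha.minus_eq)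
  next
    have "\<zero>\<^bsub>Uha\<^esub> \<in> Ann psi" by (simp add: Ann_def Uha_act_zero)
    then show "Ann psi \<noteq> {}" by auto
  qed (auto simp: Ann_def Uha_act_add)
next
  fix a x :: "nat \<Rightarrow> 'k fa set"
  assume a: "a \<in> Ann psi" and x: "x \<in> carrier Uha"
  have "Uha_act psi n x (\<lambda>k. 0) = (\<lambda>k. 0)" for n
    using carrier_Uha_ex_cls[OF x] by (auto simp: Uha_act_cls fa_act_vec_zero hsum_zero)
  with a x show "x \<otimes>\<^bsub>Uha\<^esub> a \<in> Ann psi" by (simp add: Ann_def Uha_act_mult)
  \<comment> \<open>\<open>a\<close> is known to kill only vectors of \<open>Vh\<close>, so
    \<open>Uha_act_Vh\<close> is needed for the vector produced by \<open>x\<close>.\<close>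
  show "a \<otimes>\<^bsub>Uha\<^esub> x \<in> Ann psi" using a x by (simp add: Ann_def Uha_act_mult Uha_act_Vh)
qed

text \<open>Degree \<open>d\<close> of the result of an action depends only on the coefficients of
  index at most \<open>d\<close> of the acting series.\<close>

lemma hadic_closed_Ann: "hadic_closed (Ann psi :: (nat \<Rightarrow> 'k::field fa set) set)"
  unfolding hadic_closed_def
proof (intro ballI impI)
  fix x :: "nat \<Rightarrow> 'k fa set"
  assume x: "x \<in> carrier Uha" and lim: "\<forall>N. \<exists>g\<in>Ann psi. \<forall>n<N. x n = g n"
  have "Uha_act psi n x c k = 0" if c: "c \<in> Vh" for n c k
  proof (rule fps_ext)
    fix d
    obtain g where g: "g \<in> Ann psi" "\<forall>n<Suc d. x n = g n" 
      using spec[OF lim, of "Suc d"] by (elim bexE) (rule that)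
    then have "fps_nth (Uha_act psi n x c k) d = fps_nth (Uha_act psi n g c k) d"
      by (auto simp: Uha_act_def intro!: sum.cong)
    then show "fps_nth (Uha_act psi n x c k) d = fps_nth 0 d"
      using g(1) c by (simp add: Ann_def)
  qed
  then show "x \<in> Ann psi" using x by (auto simp: Ann_def)
qed

section \<open>Scalars and the quantum relation\<close>

lemma Uh_scal_eq: "Uh_scal p = (\<lambda>n. cls (\<lambda>w. fps_nth p n * fa_word [] w))"
  by (simp add: Uh_scal_def fa_scal_def free_alg_simps)

lemma Uh_scal_closed: "Uh_scal p \<in> carrier Uha"
  unfolding Uh_scal_eq by (intro cls_in_Uha fa_scale_closed fa_word_closed)

lemma Uh_scal_mult: "Uh_scal p \<otimes>\<^bsub>Uha\<^esub> Uh_scal r = Uh_scal (p * r)"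
proof -
  have "(\<Sum>i\<le>n. fa_mult (\<lambda>w. fps_nth p i * fa_word [] w) (\<lambda>w. fps_nth r (n - i) * fa_word [] w) w)
      = fps_nth (p * r) n * fa_word [] w" for n w
    by (simp add: fa_mult_linear fa_mult_word_word fps_mult_nth sum_distrib_right atLeast0AtMost mult.assoc)
  then show ?thesis
    unfolding Uh_scal_eq by (simp add: Uha_mult_cls fa_scale_closed fa_word_closed)
qed

lemma Uh_scal_one: "Uh_scal 1 = \<one>\<^bsub>Uha\<^esub>"
  by (auto simp: fun_eq_iff Uh_scal_eq Uha_simps cls_one cls_zero)

text \<open>Through this shift, a series with zero constant term can be divided by h in exactly one
  way.\<close>

lemma Uh_scal_X_mult:
  assumes "x \<in> carrier Uha"
  shows "Uh_scal fps_X \<otimes>\<^bsub>Uha\<^esub> x = (\<lambda>n. if n = 0 then \<zero>\<^bsub>Ua\<^esub> else x (n - 1))"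
proof
  fix n
  have coeff: "Uh_scal fps_X i = (if i = 1 then \<one>\<^bsub>Ua\<^esub> else \<zero>\<^bsub>Ua\<^esub>)" for i
    by (simp add: Uh_scal_eq cls_one cls_zero)
  have xc: "x i \<in> carrier Ua" for i using assms by (simp add: Uha_simps)
  show "(Uh_scal fps_X \<otimes>\<^bsub>Uha\<^esub> x) n = (if n = 0 then \<zero>\<^bsub>Ua\<^esub> else x (n - 1))"
  proof (cases "n = 0")
    case True
    then show ?thesis
      by (subst Uha_mult_single[OF Uh_scal_closed assms, where j = 0]) (auto simp: coeff xc)
  next
    case False
    then show ?thesis
      by (subst Uha_mult_single[OF Uh_scal_closed assms, where j = 1]) (auto simp: coeff xc)
  qed
qed

lemma Uha_act_scal: "Uha_act psi n (Uh_scal p) c = (\<lambda>k. p * c k)"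
  by (simp add: Uh_scal_eq Uha_act_cls fa_scale_closed fa_word_closed fa_act_scale fa_act_word
      word_act_Nil hsum_scalars)

lemma Uha_act_scal_mult:
  "x \<in> carrier Uha \<Longrightarrow> Uha_act psi n (Uh_scal p \<otimes>\<^bsub>Uha\<^esub> x) c = (\<lambda>k. p * Uha_act psi n x c k)"
  by (simp add: Uha_act_mult Uh_scal_closed Uha_act_scal)

text \<open>The scalar is h times a unit: \<open>s\<close> is inverted, and h is cancelled by the
  index shift. This justifies the description operator in \<open>qH_quot\<close>.\<close>

lemma Uh_scal_div_unique:
  fixes s :: "'k::field fps"
  assumes s: "fps_nth s 0 \<noteq> 0" and y: "y \<in> carrier Uha" "y 0 = \<zero>\<^bsub>Ua\<^esub>"
  shows "\<exists>!x. x \<in> carrier Uha \<and> Uh_scal (fps_X * s) \<otimes>\<^bsub>Uha\<^esub> x = y"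
proof (rule ex_ex1I)
  have inv: "Uh_scal s \<otimes>\<^bsub>Uha\<^esub> (Uh_scal (inverse s) \<otimes>\<^bsub>Uha\<^esub> x) = x"
    "Uh_scal (inverse s) \<otimes>\<^bsub>Uha\<^esub> (Uh_scal s \<otimes>\<^bsub>Uha\<^esub> x) = x" if "x \<in> carrier Uha" for x
    using that s by (simp_all add: Uha.m_assoc[symmetric] Uh_scal_closed Uh_scal_mult inverse_mult_eq_1
        inverse_mult_eq_1' Uh_scal_one)
  define y' where "y' = (\<lambda>n. y (Suc n))"
  have y': "y' \<in> carrier Uha" using y by (simp add: y'_def Uha_simps)
  have "Uh_scal fps_X \<otimes>\<^bsub>Uha\<^esub> y' = y"
    unfolding Uh_scal_X_mult[OF y'] using y(2) by (intro ext) (simp add: y'_def)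
  then show "\<exists>x. x \<in> carrier Uha \<and> Uh_scal (fps_X * s) \<otimes>\<^bsub>Uha\<^esub> x = y"
    by (intro exI[of _ "Uh_scal (inverse s) \<otimes>\<^bsub>Uha\<^esub> y'"])
       (simp add: Uh_scal_mult[symmetric] Uha.m_assoc Uh_scal_closed y' inv)
  fix x x'
  assume "x \<in> carrier Uha \<and> Uh_scal (fps_X * s) \<otimes>\<^bsub>Uha\<^esub> x = y"
    "x' \<in> carrier Uha \<and> Uh_scal (fps_X * s) \<otimes>\<^bsub>Uha\<^esub> x' = y"
  then have xx: "x \<in> carrier Uha" "x' \<in> carrier Uha"
    and "Uh_scal fps_X \<otimes>\<^bsub>Uha\<^esub> (Uh_scal s \<otimes>\<^bsub>Uha\<^esub> x) = Uh_scal fps_X \<otimes>\<^bsub>Uha\<^esub> (Uh_scal s \<otimes>\<^bsub>Uha\<^esub> x')"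
    by (auto simp: Uh_scal_mult[symmetric] Uha.m_assoc Uh_scal_closed)
  then have "(Uh_scal s \<otimes>\<^bsub>Uha\<^esub> x) n = (Uh_scal s \<otimes>\<^bsub>Uha\<^esub> x') n" for n
    by (drule_tac x = "Suc n" in fun_cong) (simp add: Uh_scal_X_mult Uh_scal_closed)
  then have "Uh_scal s \<otimes>\<^bsub>Uha\<^esub> x = Uh_scal s \<otimes>\<^bsub>Uha\<^esub> x'" by (rule ext)
  then show "x = x'" using inv(2) xx by metis
qed

text \<open>The conditional stands inside \<open>cls\<close>, so that every coefficient is visibly a
  class and the rules for series of classes apply.\<close>

definition Uh_const :: "'k::field fa \<Rightarrow> nat \<Rightarrow> 'k fa set" where
  "Uh_const f = (\<lambda>n. cls (if n = 0 then f else (\<lambda>w. 0)))"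

lemma fa_zero_closed: "(\<lambda>w. 0) \<in> carrier free_alg"
  by (simp add: free_alg_simps)

lemma Uh_const_closed: "f \<in> carrier free_alg \<Longrightarrow> Uh_const f \<in> carrier Uha"
  unfolding Uh_const_def by (intro cls_in_Uha) (simp add: fa_zero_closed)

lemma Uh_gen_eq: "Uh_gen g = Uh_const (fa_gen g)"
  by (rule ext) (simp add: Uh_gen_def Uh_const_def cls_zero)

lemma Uha_act_const:
  assumes "f \<in> carrier free_alg"
  shows "Uha_act psi n (Uh_const f) c = fa_act psi n f c"
proof -
  have "hsum (\<lambda>m. fa_act psi n (if m = 0 then f else (\<lambda>w. 0)) c k) = fa_act psi n f c k" for k
  proof -
    \<comment> \<open>The coefficients of the series \<open>1\<close> encode the case distinction,
      which brings the sum into the form of \<open>hsum_scalars\<close>.\<close>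
    have "(\<lambda>m. fa_act psi n (if m = 0 then f else (\<lambda>w. 0)) c k)
        = (\<lambda>m. fps_const (fps_nth 1 m) * fa_act psi n f c k)"
      by (auto simp: fa_act_zero)
    then show ?thesis by (simp only: hsum_scalars mult_1)
  qed
  then show ?thesis
    using assms unfolding Uh_const_def by (subst Uha_act_cls) (simp_all add: fa_zero_closed)
qed

lemma Uha_act_gen: "Uha_act psi n (Uh_gen g) c = gen_act psi n g c"
  by (simp add: Uh_gen_eq Uha_act_const fa_gen_closed) (simp add: fa_gen_eq_word fa_act_word word_act_Cons word_act_Nil)

lemma fa_gen_pow: "fa_gen g [^]\<^bsub>free_alg\<^esub> (n::nat) = fa_word (replicate n g)"
  by (induction n) (simp_all add: free_alg_simps fa_gen_eq_word fa_mult_word_word replicate_append_same)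

lemma Uh_expH_eq: "Uh_expH a = (\<lambda>n. cls (\<lambda>w. a ^ n / fact n * fa_word (replicate n GH) w))"
  by (simp add: Uh_expH_def fa_gen_pow fa_scal_def)

lemma Uh_expH_closed: "Uh_expH a \<in> carrier Uha"
  unfolding Uh_expH_eq by (intro cls_in_Uha fa_scale_closed fa_word_closed)

lemma word_act_H_power:
  "word_act psi n (replicate m GH) c = (\<lambda>k. fps_const (of_int (n - 2 * int k) ^ m) * c k)"
proof (induction m)
  case (Suc m)
  have "of_int (n - 2 * int k) * (fps_const (of_int (n - 2 * int k) ^ m) * c k)
      = fps_const (of_int (n - 2 * int k) ^ Suc m) * c k" for k
    by (simp only: fps_of_int[symmetric] fps_const_mult mult.assoc[symmetric] power_Suc)
  with Suc show ?case by (simp add: word_act_Cons gen_act_def fun_eq_iff)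
qed (simp add: word_act_Nil)

text \<open>On the coordinate \<open>k\<close> each \<open>GH\<close> is the scalar
  \<open>n - 2 * k\<close>, so the exponential series in \<open>GH\<close> sums to the exponential
  of that eigenvalue.\<close>

lemma Uha_act_expH: "Uha_act psi n (Uh_expH a) c = (\<lambda>k. fps_exp (a * of_int (n - 2 * int k)) * c k)"
proof -
  have "hsum (\<lambda>m. fps_const (a ^ m / fact m) * (fps_const (of_int (n - 2 * int k) ^ m) * c k))
      = fps_exp (a * of_int (n - 2 * int k)) * c k" for k
    by (subst hsum_scalars[symmetric], rule arg_cong[of _ _ hsum])
       (simp add: fun_eq_iff fps_exp_def power_mult_distrib mult.assoc[symmetric])
  then show ?thesis
    by (simp only: Uh_expH_eq Uha_act_cls fa_scale_closed fa_word_closed fa_act_scale fa_act_word word_act_H_power)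
qed

section \<open>Quantum integers and the element \<open>qH_quot\<close>\<close>

definition qdiff :: "'k::field_char_0 fps" where
  "qdiff = fps_exp 1 - fps_exp (- 1)"

lemma qdiff_nth: "fps_nth qdiff 0 = 0" "fps_nth qdiff 1 = 2"
  by (simp_all add: qdiff_def)

text \<open>The cofactor of h has constant term 2, a unit in characteristic zero; division by
  \<open>qdiff\<close> thus amounts to division by h.\<close>

lemma qdiff_eq: "qdiff = fps_X * fps_shift 1 qdiff"
  by (rule fps_ext) (auto simp: qdiff_nth)

lemma qdiff_nonzero: "qdiff \<noteq> (0 :: 'k::field_char_0 fps)"
  by (metis fps_zero_nth qdiff_nth(2) zero_neq_numeral)

lemma qH_quot_props:
  "(qH_quot :: nat \<Rightarrow> 'k::field_char_0 fa set) \<in> carrier Uha" (is ?A)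
  "Uh_scal qdiff \<otimes>\<^bsub>Uha\<^esub> qH_quot = Uh_expH 1 \<ominus>\<^bsub>Uha\<^esub> Uh_expH (- 1 :: 'k)" (is ?B)
proof -
  let ?y = "Uh_expH 1 \<ominus>\<^bsub>Uha\<^esub> Uh_expH (- 1 :: 'k)"
  have "?y 0 = \<zero>\<^bsub>Ua\<^esub>"
    by (simp add: Uha_minus Uh_expH_closed) (simp add: Uh_expH_eq cls_diff fa_word_closed cls_zero)
  then have "\<exists>!x. x \<in> carrier Uha \<and> Uh_scal qdiff \<otimes>\<^bsub>Uha\<^esub> x = ?y"
    by (subst qdiff_eq, intro Uh_scal_div_unique) (simp_all add: qdiff_nth[simplified] Uh_expH_closed)
  from theI'[OF this] show ?A ?B unfolding qH_quot_def qdiff_def by simp_all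
qed

text \<open>The \<open>div\<close> in \<open>qint\<close> is exact: the numerator has zero constant
  term, hence is divisible by h and so by \<open>qdiff\<close>.\<close>

lemma qdiff_mult_qint: "qdiff * qint z = fps_exp (of_int z) - fps_exp (- of_int z)"
proof -
  let ?a = "fps_exp (of_int z) - fps_exp (- of_int z) :: 'a fps"
  have "?a = fps_X * fps_shift 1 ?a"
    by (rule fps_ext) auto
  also have "\<dots> = qdiff * (inverse (fps_shift 1 qdiff) * fps_shift 1 ?a)"
  proof -
    have "fps_shift 1 qdiff * inverse (fps_shift 1 qdiff) = (1 :: 'a fps)"
      by (rule inverse_mult_eq_1') (simp add: qdiff_nth[simplified])
    then have "fps_X * fps_shift 1 ?a = fps_X * (fps_shift 1 qdiff * inverse (fps_shift 1 qdiff)) * fps_shift 1 ?a"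
      by simp
    also have "\<dots> = qdiff * (inverse (fps_shift 1 qdiff) * fps_shift 1 ?a)"
      by (subst (3) qdiff_eq) (simp only: mult_ac)
    finally show ?thesis .
  qed
  finally have "qdiff dvd ?a" by (rule dvdI)
  then show ?thesis unfolding qint_def qdiff_def[symmetric] by simp
qed

text \<open>Compare coefficients in degree one: \<open>qdiff\<close> begins with \<open>2 h\<close>,
  the numerator with \<open>2 z h\<close>.\<close>

lemma qint_nth_0: "fps_nth (qint z) 0 = of_int z"
proof -
  have "fps_nth (qdiff * qint z :: 'a fps) 1 = 2 * of_int z"
    unfolding qdiff_mult_qint by simp
  then show ?thesis by (simp add: fps_mult_nth qdiff_nth[simplified])
qed

lemma qC_nth_0: "fps_nth (qC k n) 0 = of_int (int k * (n - int k + 1))"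
  by (simp add: qC_def qint_nth_0)

lemma qC_0: "qC 0 n = 0"
proof -
  have "qdiff * qint 0 = (0 :: 'a fps)" by (simp add: qdiff_mult_qint)
  then show ?thesis using qdiff_nonzero[where 'k = 'a] by (simp add: qC_def)
qed

text \<open>The product formula for hyperbolic sines with cleared denominators.\<close>

lemma qint_mult: "qdiff * qdiff * (qint a * qint b) =
   (fps_exp (of_int (a + b)) + fps_exp (of_int (- (a + b))))
   - (fps_exp (of_int (a - b)) + fps_exp (of_int (b - a)))"
proof -
  have "qdiff * qdiff * (qint a * qint b) = (qdiff * qint a) * (qdiff * qint b)" by (simp add: mult_ac)
  also have "\<dots> = (fps_exp (of_int a) - fps_exp (of_int (- a))) * (fps_exp (of_int b) - fps_exp (of_int (- b)))"
    by (simp add: qdiff_mult_qint)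
  finally show ?thesis
    by (simp add: left_diff_distrib right_diff_distrib fps_exp_add_mult[symmetric] algebra_simps)
qed

lemma qint_1: "qint 1 = 1"
proof -
  have "qdiff * qint 1 = (qdiff * 1 :: 'a fps)" unfolding qdiff_mult_qint by (simp add: qdiff_def)
  then show ?thesis using qdiff_nonzero[where 'k = 'a] by (simp only: mult_cancel_left) auto
qed

text \<open>In both products the two indices add up to \<open>n + 1\<close>, so the exponentials of
  the index sums cancel and only those of the index differences remain.\<close>

lemma qC_Suc_diff: "qC (Suc k) n - qC k n = qint (n - 2 * int k)"
proof -
  \<comment> \<open>The factor \<open>qint 1\<close> equals 1 and is inserted to make
    \<open>qint_mult\<close> applicable on the right as well.\<close>
  have "qdiff * qdiff * (qC (Suc k) n - qC k n) = qdiff * qdiff * (qint (n - 2 * int k) * qint 1 :: 'a fps)"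
    unfolding qC_def right_diff_distrib qint_mult by (simp add: algebra_simps)
  then show ?thesis using qdiff_nonzero[where 'k = 'a] by (simp add: qint_1)
qed

text \<open>\<open>qH_quot\<close> is accessible only through its defining equation;
  \<open>qdiff\<close> is cancelled afterwards because power series over a field form a
  domain.\<close>

lemma Uha_act_qH_quot: "Uha_act psi n qH_quot c = (\<lambda>k. qint (n - 2 * int k) * c k)"
proof
  fix k
  have "qdiff * Uha_act psi n qH_quot c k = Uha_act psi n (Uh_scal qdiff \<otimes>\<^bsub>Uha\<^esub> qH_quot) c k"
    by (simp add: Uha_act_scal_mult qH_quot_props(1))
  also have "\<dots> = qdiff * qint (n - 2 * int k) * c k"
    unfolding qH_quot_props(2) qdiff_mult_qint
    by (simp add: Uha_act_minus Uh_expH_closed Uha_act_expH left_diff_distrib)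
  finally show "Uha_act psi n qH_quot c k = qint (n - 2 * int k) * c k"
    using qdiff_nonzero[where 'k = 'a] by (simp add: mult.assoc)
qed

text \<open>Degree one of the defining equation says that twice the constant term is twice the class
  of \<open>GH\<close>.\<close>

lemma qH_quot_nth_0: "qH_quot 0 = cls (fa_gen GH)"
proof -
  obtain f where f: "\<And>n. f n \<in> carrier free_alg" "(qH_quot :: nat \<Rightarrow> 'a fa set) = (\<lambda>n. cls (f n))"
    using carrier_Uha_ex_cls[OF qH_quot_props(1)] by blast
  have "cls (\<lambda>w. 2 * f 0 w) = (Uh_scal qdiff \<otimes>\<^bsub>Uha\<^esub> qH_quot) 1"
    unfolding f(2) Uh_scal_eq
    by (subst Uha_mult_cls)
       (simp_all add: f(1) fa_scale_closed fa_word_closed fa_mult_linear fa_mult_word_Nil_left qdiff_nth[simplified])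
  also have "\<dots> = cls (\<lambda>w. 2 * fa_word [GH] w)"
    unfolding qH_quot_props(2) Uha_minus[OF Uh_expH_closed Uh_expH_closed]
    unfolding Uh_expH_eq
    by (subst cls_diff) (auto simp: fa_scale_closed[of _ "-1", simplified] fa_word_closed algebra_simps
        mult_2[symmetric] intro!: arg_cong[of _ _ cls])
  finally have eq: "cls (\<lambda>w. 2 * f 0 w) = cls (\<lambda>w. 2 * fa_word [GH] w)" .
  \<comment> \<open>The factor 2 is cancelled inside \<open>Ua\<close> by multiplying with the class
    of the scalar 1/2.\<close>
  let ?half = "cls (\<lambda>w. (1/2) * fa_word [] w) :: 'a fa set"
  have "?half \<otimes>\<^bsub>Ua\<^esub> cls (\<lambda>w. 2 * g w) = cls g" if "g \<in> carrier free_alg" for g :: "'a fa"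
  proof -
    have "fa_mult (\<lambda>w. (1/2) * fa_word [] w) (\<lambda>w. 2 * g w) = g"
      by (simp only: fun_eq_iff fa_mult_linear fa_mult_word_Nil_left) simp
    then show ?thesis
      using that cls_mult[OF fa_scale_closed[OF fa_word_closed] fa_scale_closed, of g "1/2" "[]" 2] by simp
  qed
  from this[OF f(1)[of 0]] this[OF fa_word_closed] eq show ?thesis
    by (simp add: f(2) fa_gen_eq_word)
qed

lemma Uh_rel_closed: "Uh_rel \<in> carrier Uha"
  by (simp add: Uh_rel_def Uh_gen_eq Uh_const_closed fa_gen_closed qH_quot_props)

lemma Uh_rel_in_Ann_qC: "Uh_rel \<in> Ann (qC :: nat \<Rightarrow> int \<Rightarrow> 'k::field_char_0 fps)"
proof -
  have "Uha_act qC n Uh_rel c k = 0" for n k and c :: "nat \<Rightarrow> 'k fps"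
  proof -
    have gen: "Uh_gen g \<in> carrier (Uha :: (nat \<Rightarrow> 'k fa set) ring)" for g
      by (simp add: Uh_gen_eq Uh_const_closed fa_gen_closed)
    \<comment> \<open>At \<open>k = 0\<close> the term with \<open>GXm\<close> applied last
      contributes nothing; \<open>qC_0\<close> then brings this case into the general form.\<close>
    have "Uha_act qC n Uh_rel c k = (if k = 0 then qC 1 n * c k else (qC (Suc k) n - qC k n) * c k)
        - qint (n - 2 * int k) * c k"
      unfolding Uh_rel_def
      by (simp add: Uha_act_minus Uha_act_mult gen qH_quot_props(1) Uha_act_qH_quot Uha_act_gen
          gen_act_def left_diff_distrib)
    also have "\<dots> = 0" using qC_Suc_diff[of k n] by (cases "k = 0") (auto simp: qC_0)
    finally show ?thesis .
  qed
  then show ?thesis by (auto simp: Ann_def Uh_rel_closed)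
qed

section \<open>Classical Verma modules are jointly faithful\<close>

lemma Isl2_add: "f \<in> Isl2 \<Longrightarrow> g \<in> Isl2 \<Longrightarrow> (\<lambda>w. f w + g w) \<in> Isl2"
  using additive_subgroup.a_closed[OF ideal.axioms(1)[OF ideal_Isl2]] by (simp add: free_alg_simps(5))

lemma Isl2_mult_left: "f \<in> Isl2 \<Longrightarrow> g \<in> carrier free_alg \<Longrightarrow> fa_mult g f \<in> Isl2"
  using ideal.I_l_closed[OF ideal_Isl2] by (simp add: free_alg_simps(2))

lemma Isl2_mult_right: "f \<in> Isl2 \<Longrightarrow> g \<in> carrier free_alg \<Longrightarrow> fa_mult f g \<in> Isl2"
  using ideal.I_r_closed[OF ideal_Isl2] by (simp add: free_alg_simps(2))

lemma Isl2_scale: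
  assumes "f \<in> Isl2"
  shows "(\<lambda>w. a * f w) \<in> Isl2"
proof -
  have "fa_mult (\<lambda>w. a * fa_word [] w) f = (\<lambda>w. a * f w)"
    by (simp add: fun_eq_iff fa_mult_linear fa_mult_word_Nil_left)
  then show ?thesis
    using Isl2_mult_left[OF assms fa_scale_closed[OF fa_word_closed], of a "[]"] by simp
qed

lemma Isl2_zero: "(\<lambda>w. 0) \<in> Isl2"
  using additive_subgroup.zero_closed[OF ideal.axioms(1)[OF ideal_Isl2]] by (simp add: free_alg_simps(4))

lemma Isl2_carrier: "f \<in> Isl2 \<Longrightarrow> f \<in> carrier free_alg"
  by (rule ideal.Icarr[OF ideal_Isl2])

definition normal_word :: "nat \<Rightarrow> nat \<Rightarrow> nat \<Rightarrow> agen list" where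
  "normal_word a b c = replicate a GXm @ replicate b GH @ replicate c GXp"

text \<open>Only the spanning half of the Poincare--Birkhoff--Witt theorem is needed (all elements are
  straight); independence of the ordered monomials comes from the Verma modules.\<close>

definition straight :: "'k::field fa set" where
  "straight = {f \<in> carrier free_alg. \<exists>g\<in>carrier free_alg.
     (\<forall>w. g w \<noteq> 0 \<longrightarrow> (\<exists>a b c. w = normal_word a b c)) \<and> (\<lambda>w. f w - g w) \<in> Isl2}"

lemma straight_normal_word: "fa_word (normal_word a b c) \<in> straight"
  using Isl2_zero
  by (auto simp: straight_def fa_word_closed intro!: bexI[of _ "fa_word (normal_word a b c)"])
     (auto simp: fa_word_def split: if_splits)

lemma straight_Isl2: "f \<in> Isl2 \<Longrightarrow> f \<in> straight"
  by (auto simp: straight_def Isl2_carrier fa_zero_closed intro!: bexI[of _ "\<lambda>w. 0"])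

lemma straight_add:
  assumes "f \<in> straight" "g \<in> straight"
  shows "(\<lambda>w. f w + g w) \<in> straight"
proof -
  from assms obtain f' g' where
    f': "f' \<in> carrier free_alg" "\<forall>w. f' w \<noteq> 0 \<longrightarrow> (\<exists>a b c. w = normal_word a b c)" "(\<lambda>w. f w - f' w) \<in> Isl2" and
    g': "g' \<in> carrier free_alg" "\<forall>w. g' w \<noteq> 0 \<longrightarrow> (\<exists>a b c. w = normal_word a b c)" "(\<lambda>w. g w - g' w) \<in> Isl2"
    by (auto simp: straight_def)
  have "(\<lambda>w. (f w + g w) - (f' w + g' w)) \<in> Isl2"
    using Isl2_add[OF f'(3) g'(3)] by (simp add: algebra_simps)
  moreover have "\<forall>w. f' w + g' w \<noteq> 0 \<longrightarrow> (\<exists>a b c. w = normal_word a b c)"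
    using f'(2) g'(2) by (metis add.right_neutral)
  ultimately show ?thesis
    using assms fa_add_closed[OF f'(1) g'(1)] unfolding straight_def
    by (auto simp: fa_add_closed intro!: bexI[of _ "\<lambda>w. f' w + g' w"])
qed

lemma straight_scale:
  assumes "f \<in> straight"
  shows "(\<lambda>w. a * f w) \<in> straight"
proof -
  from assms obtain f' where
    f': "f' \<in> carrier free_alg" "\<forall>w. f' w \<noteq> 0 \<longrightarrow> (\<exists>a b c. w = normal_word a b c)" "(\<lambda>w. f w - f' w) \<in> Isl2"
    by (auto simp: straight_def)
  have "(\<lambda>w. a * f w - a * f' w) \<in> Isl2"
    using Isl2_scale[OF f'(3), of a] by (simp add: algebra_simps)
  moreover have "\<forall>w. a * f' w \<noteq> 0 \<longrightarrow> (\<exists>a b c. w = normal_word a b c)"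
    using f'(2) by auto
  ultimately show ?thesis
    using assms fa_scale_closed[OF f'(1), of a] unfolding straight_def
    by (auto simp: fa_scale_closed intro!: bexI[of _ "\<lambda>w. a * f' w"])
qed

lemma straight_cong:
  assumes "(\<lambda>w. f w - g w) \<in> Isl2" "g \<in> straight"
  shows "f \<in> straight"
  using straight_add[OF straight_Isl2[OF assms(1)] assms(2)] by simp

lemma straight_sum:
  assumes "finite S" "\<And>i. i \<in> S \<Longrightarrow> f i \<in> straight"
  shows "(\<lambda>w. \<Sum>i\<in>S. f i w) \<in> straight"
  using assms
  by (induction S rule: finite_induct) (simp_all add: straight_add straight_Isl2 Isl2_zero)

lemma fa_expand:
  assumes "f \<in> carrier free_alg"
  shows "f = (\<lambda>u. \<Sum>w | f w \<noteq> 0. f w * fa_word w u)"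
proof
  fix u
  have "(\<Sum>w | f w \<noteq> 0. f w * fa_word w u) = (\<Sum>w | f w \<noteq> 0. if w = u then f w else 0)"
    by (intro sum.cong) (auto simp: fa_word_def)
  also have "\<dots> = f u" using assms by (auto simp: free_alg_simps)
  finally show "f u = (\<Sum>w | f w \<noteq> 0. f w * fa_word w u)" ..
qed

lemma fa_mult_sum_right: "fa_mult h (\<lambda>u. \<Sum>i\<in>S. f i u) w = (\<Sum>i\<in>S. fa_mult h (f i) w)"
  by (simp add: fa_mult_def sum_distrib_left sum.swap[of _ S])

text \<open>By linearity only ordered words need checking; the error term stays in
  \<open>Isl2\<close> because that is an ideal.\<close>

lemma straight_mult_gen:
  assumes gen: "\<And>a b c. fa_word (x # normal_word a b c) \<in> (straight :: 'k fa set)"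
    and f: "(f :: 'k::field fa) \<in> straight"
  shows "fa_mult (fa_word [x]) f \<in> straight"
proof -
  from f obtain g where
    g: "g \<in> carrier free_alg" "\<forall>w. g w \<noteq> 0 \<longrightarrow> (\<exists>a b c. w = normal_word a b c)" "(\<lambda>w. f w - g w) \<in> Isl2"
    by (auto simp: straight_def)
  have "fa_mult (fa_word [x]) g = (\<lambda>u. \<Sum>w | g w \<noteq> 0. g w * fa_word (x # w) u)"
    by (subst fa_expand[OF g(1)]) (simp add: fun_eq_iff fa_mult_sum_right fa_mult_linear fa_mult_word_word)
  also have "\<dots> \<in> straight"
  proof (intro straight_sum straight_scale)
    show "finite {w. g w \<noteq> 0}" using g(1) by (simp add: free_alg_simps)
    show "fa_word (x # w) \<in> (straight :: 'k fa set)" if "w \<in> {w. g w \<noteq> 0}" for w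
    proof -
      obtain a b c where "w = normal_word a b c" using g(2) \<open>w \<in> {w. g w \<noteq> 0}\<close> by blast
      then show ?thesis by (simp add: gen)
    qed
  qed
  finally have "fa_mult (fa_word [x]) g \<in> straight" .
  moreover have "fa_mult (fa_word [x]) (\<lambda>w. f w - g w) = (\<lambda>w. fa_mult (fa_word [x]) f w - fa_mult (fa_word [x]) g w)"
    by (simp add: fun_eq_iff fa_mult_linear)
  ultimately show ?thesis
    using straight_cong[of "fa_mult (fa_word [x]) f" "fa_mult (fa_word [x]) g"]
      Isl2_mult_left[OF g(3) fa_word_closed[of "[x]"]] by simp
qed

text \<open>Exchange rules for the three wrongly ordered pairs of letters, before any tail
  \<open>r\<close>. Their shape fits \<open>straight_cong\<close> followed by
  \<open>straight_add\<close> and \<open>straight_scale\<close>.\<close>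

lemma Isl2_relations:
  fixes r :: "agen list"
  shows "(\<lambda>u. fa_word (GH # GXm # r) u - (fa_word (GXm # GH # r) u + (- 2) * fa_word (GXm # r) u))
      \<in> (Isl2 :: 'k::field fa set)" (is "?f \<in> _")
    and "(\<lambda>u. fa_word (GXp # GH # r) u - (fa_word (GH # GXp # r) u + (- 2) * fa_word (GXp # r) u))
      \<in> (Isl2 :: 'k fa set)" (is "?g \<in> _")
    and "(\<lambda>u. fa_word (GXp # GXm # r) u - (fa_word (GXm # GXp # r) u + fa_word (GH # r) u))
      \<in> (Isl2 :: 'k fa set)" (is "?h \<in> _")
proof -
  have "?f = fa_mult rel_Xm (fa_word r)"
    by (simp add: rel_Xm_eq fun_eq_iff fa_mult_linear fa_mult_word_word)
  then show "?f \<in> Isl2" by (simp only: Isl2_mult_right[OF rel_in_Isl2(2) fa_word_closed])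
  have "?g = (\<lambda>u. - 1 * fa_mult rel_Xp (fa_word r) u)"
    by (simp add: rel_Xp_eq fun_eq_iff fa_mult_linear fa_mult_word_word)
  then show "?g \<in> Isl2" by (simp only: Isl2_scale Isl2_mult_right[OF rel_in_Isl2(1) fa_word_closed])
  have "?h = fa_mult rel_sl2 (fa_word r)"
    by (simp add: rel_sl2_eq fun_eq_iff fa_mult_linear fa_mult_word_word)
  then show "?h \<in> Isl2" by (simp only: Isl2_mult_right[OF rel_in_Isl2(3) fa_word_closed])
qed

lemma normal_word_simps:
  "normal_word (Suc a) b c = GXm # normal_word a b c"
  "normal_word 0 (Suc b) c = GH # normal_word 0 b c"
  "normal_word 0 0 (Suc c) = GXp # normal_word 0 0 c"
  by (simp_all add: normal_word_def)

lemma straight_Xm: "f \<in> straight \<Longrightarrow> fa_mult (fa_word [GXm]) f \<in> straight"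
  by (rule straight_mult_gen) (use straight_normal_word in \<open>simp_all add: normal_word_simps(1)[symmetric]\<close>)

lemma straight_Xm_word: "fa_word w \<in> (straight :: 'k::field fa set) \<Longrightarrow> fa_word (GXm # w) \<in> (straight :: 'k fa set)"
  using straight_Xm[of "fa_word w"] by (simp add: fa_mult_word_word)

lemma straight_H_normal_word: "fa_word (GH # normal_word a b c) \<in> straight"
proof (induction a)
  case 0
  then show ?case using straight_normal_word by (simp add: normal_word_simps(2)[symmetric])
next
  case (Suc a)
  show ?case unfolding normal_word_simps
    by (rule straight_cong[OF Isl2_relations(1)] straight_add straight_scale straight_Xm_word Suc
        straight_normal_word)+
qed

lemma straight_H: "f \<in> straight \<Longrightarrow> fa_mult (fa_word [GH]) f \<in> straight"
  by (rule straight_mult_gen) (simp_all add: straight_H_normal_word)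

lemma straight_H_word: "fa_word w \<in> (straight :: 'k::field fa set) \<Longrightarrow> fa_word (GH # w) \<in> (straight :: 'k fa set)"
  using straight_H[of "fa_word w"] by (simp add: fa_mult_word_word)

text \<open>\<open>GXp\<close> first moves past the letters \<open>GXm\<close>, then past the
  letters \<open>GH\<close>. Each exchange with \<open>GXm\<close> creates a \<open>GH\<close>,
  which is why the case of \<open>GH\<close> had to come before.\<close>

lemma straight_Xp_normal_word: "fa_word (GXp # normal_word a b c) \<in> straight"
proof (induction a)
  case 0
  then show ?case
  proof (induction b)
    case 0
    then show ?case using straight_normal_word by (simp add: normal_word_simps(3)[symmetric])
  next
    case (Suc b)
    show ?case unfolding normal_word_simps
      by (rule straight_cong[OF Isl2_relations(2)] straight_add straight_scale straight_H_word Suc)+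
  qed
next
  case (Suc a)
  show ?case unfolding normal_word_simps
    by (rule straight_cong[OF Isl2_relations(3)] straight_add straight_Xm_word Suc
        straight_H_normal_word)+
qed

lemma straight_Xp: "f \<in> straight \<Longrightarrow> fa_mult (fa_word [GXp]) f \<in> straight"
  by (rule straight_mult_gen) (simp_all add: straight_Xp_normal_word)

lemma straight_word: "fa_word w \<in> (straight :: 'k::field fa set)"
proof (induction w)
  case Nil
  then show ?case using straight_normal_word[of 0 0 0] by (simp add: normal_word_def)
next
  case (Cons x w)
  then have "fa_mult (fa_word [x]) (fa_word w) \<in> (straight :: 'k fa set)"
    by (cases x) (simp_all add: straight_H straight_Xm straight_Xp)
  then show ?case by (simp add: fa_mult_word_word)
qed

lemma straight_all: "f \<in> carrier free_alg \<Longrightarrow> f \<in> straight"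
  by (induction f rule: fa_induct)
     (simp_all add: straight_Isl2 Isl2_zero straight_add straight_scale straight_word)

section \<open>Ordered monomials acting on the basis vectors \<open>b_j\<close>\<close>

definition unit_vec :: "nat \<Rightarrow> nat \<Rightarrow> 'k::field fps" where
  "unit_vec j = (\<lambda>k. if k = j then 1 else 0)"

lemma unit_vec_Vh: "unit_vec j \<in> Vh"
proof -
  have "{k. fps_nth (unit_vec j k) m \<noteq> 0} \<subseteq> {j}" for m by (auto simp: unit_vec_def)
  then show ?thesis unfolding Vh_def by (auto intro: finite_subset)
qed

lemma word_act_Xp_power:
  "word_act psi n (replicate c GXp) (unit_vec c) = (\<lambda>k. (\<Prod>l=1..c. psi l n) * unit_vec 0 k)"
proof -
  \<comment> \<open>The target index \<open>i\<close> is left free: the induction step lowers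
    \<open>b_(c+i+1)\<close> first to \<open>b_(i+1)\<close> and then once more to
    \<open>b_i\<close>.\<close>
  have "word_act psi n (replicate c GXp) (unit_vec (c + i)) = (\<lambda>k. (\<Prod>l=Suc i..c + i. psi l n) * unit_vec i k)" for i
  proof (induction c arbitrary: i)
    case 0
    then show ?case by (simp add: word_act_Nil)
  next
    case (Suc c)
    have "(\<Prod>l=Suc i..Suc (c + i). psi l n) = psi (Suc i) n * (\<Prod>l=Suc (Suc i)..Suc (c + i). psi l n)"
      by (rule prod.atLeast_Suc_atMost) simp
    then show ?case using Suc.IH[of "Suc i"]
      by (auto simp: word_act_Cons gen_act_def unit_vec_def fun_eq_iff mult_ac)
  qed
  from this[of 0] show ?thesis by simp
qed

text \<open>After \<open>j\<close> steps \<open>b_j\<close> has become a multiple of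
  \<open>b_0\<close>, and the next \<open>GXp\<close> kills it.\<close>

lemma word_act_Xp_power_eq_0:
  assumes "j < c"
  shows "word_act psi n (replicate c GXp) (unit_vec j) = (\<lambda>k. 0)"
proof -
  from assms have "replicate c GXp = replicate (c - Suc j) GXp @ GXp # replicate j GXp"
    using replicate_add[of "c - Suc j" "Suc j" GXp] by simp
  moreover have "gen_act psi n GXp (\<lambda>k. (\<Prod>l=1..j. psi l n) * unit_vec 0 k) = (\<lambda>k. 0)"
    by (simp add: gen_act_def unit_vec_def)
  ultimately show ?thesis
    by (simp add: word_act_append word_act_Cons word_act_Xp_power word_act_zero)
qed

lemma word_act_Xm_power:
  "word_act psi n (replicate a GXm) c = (\<lambda>k. if k < a then 0 else c (k - a))"
  by (induction a) (auto simp: word_act_Nil word_act_Cons gen_act_def fun_eq_iff)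

text \<open>The letters \<open>GXp\<close> kill \<open>b_j\<close> for \<open>j < c\<close> and send
  \<open>b_c\<close> to a multiple of \<open>b_0\<close>. There \<open>GH\<close> is the scalar
  \<open>n\<close>, and the letters \<open>GXm\<close> carry \<open>b_0\<close> to
  \<open>b_a\<close>.\<close>

lemma word_act_normal_word:
  assumes "j \<le> c"
  shows "word_act psi n (normal_word a b c) (unit_vec j) k
    = (if j = c \<and> k = a then fps_const (of_int n ^ b) * (\<Prod>l=1..c. psi l n) else 0)"
proof (cases "j = c")
  case True
  then show ?thesis
    by (auto simp: normal_word_def word_act_append word_act_Xp_power word_act_H_power word_act_Xm_power)
       (auto simp: unit_vec_def)
next
  case False
  then show ?thesis using assms
    by (auto simp: normal_word_def word_act_append word_act_Xp_power_eq_0 word_act_zero)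
qed

text \<open>For \<open>1 \<le> l \<le> c \<le> n\<close> both \<open>l\<close> and
  \<open>n - l + 1\<close> are positive, and characteristic zero keeps their images nonzero.\<close>

lemma natC_prod_nth_0:
  assumes "int c \<le> n"
  shows "fps_nth (\<Prod>l=1..c. natC l n) 0 \<noteq> (0 :: 'k::field_char_0)"
proof -
  have "fps_nth (\<Prod>l\<in>S. natC l n) 0 = (\<Prod>l\<in>S. of_int (int l * (n - int l + 1)) :: 'k)" if "finite S" for S
    using that by (induction S rule: finite_induct) (simp_all add: natC_def fps_of_int[symmetric])
  moreover have "int l * (n - int l + 1) \<noteq> 0" if "l \<in> {1..c}" for l
    using that assms by auto
  ultimately show ?thesis by (simp del: of_int_mult of_int_add of_int_diff)
qed

text \<open>By induction on \<open>c\<close>: applied to \<open>b_c\<close> only the monomials with exactly \<open>c\<close> factors \<open>X^+\<close>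
  survive, and the coefficient of \<open>b_a\<close> is a polynomial in \<open>n\<close> vanishing at all \<open>n \<ge> c\<close>.\<close>

lemma normal_coeff_eq_0:
  fixes g :: "'k::field_char_0 fa"
  assumes g: "g \<in> carrier free_alg" "\<And>w. g w \<noteq> 0 \<Longrightarrow> \<exists>a b c. w = normal_word a b c"
    and act: "\<And>n c k. c \<in> Vh \<Longrightarrow> fps_nth (fa_act natC n g c k) 0 = 0"
  shows "g (normal_word a b c) = 0"
proof (induction c arbitrary: a b rule: less_induct)
  case (less c)
  define B where "B = {b. g (normal_word a b c) \<noteq> 0}"
  have inj: "inj (\<lambda>b. normal_word a b c)"
  proof (rule injI)
    fix b b' assume "normal_word a b c = normal_word a b' c"
    then have "length (normal_word a b c) = length (normal_word a b' c)" by (rule arg_cong)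
    then show "b = b'" by (simp add: normal_word_def)
  qed
  have "finite ((\<lambda>b. normal_word a b c) -` {w. g w \<noteq> 0})"
    using g(1) inj by (intro finite_vimageI) (simp_all add: free_alg_simps)
  then have finB: "finite B" by (simp add: B_def vimage_def)
  \<comment> \<open>With \<open>a\<close> and \<open>c\<close> fixed, the exponent of
    \<open>GH\<close> becomes the degree, since \<open>GH\<close> acts on \<open>b_0\<close> by
    \<open>n\<close>.\<close>
  define p where "p = (\<Sum>b\<in>B. Polynomial.monom (g (normal_word a b c)) b)"
  have root: "poly p (of_int n) = 0" if n: "int c \<le> n" for n
  proof -
    define K :: 'k where "K = fps_nth (\<Prod>l=1..c. natC l n) 0"
    define t where "t w = fps_nth (fps_const (g w) * word_act natC n w (unit_vec c) a) 0" for w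
    have "0 = fps_nth (fa_act natC n g (unit_vec c) a) 0"
      by (simp add: act unit_vec_Vh)
    also have "\<dots> = (\<Sum>w | g w \<noteq> 0. t w)"
      by (simp only: fa_act_def fps_sum_nth t_def)
    also have "\<dots> = (\<Sum>w\<in>(\<lambda>b. normal_word a b c) ` B. t w)"
    proof (rule sum.mono_neutral_right)
      show "\<forall>w\<in>{w. g w \<noteq> 0} - (\<lambda>b. normal_word a b c) ` B. t w = 0"
      proof
        fix w assume w: "w \<in> {w. g w \<noteq> 0} - (\<lambda>b. normal_word a b c) ` B"
        then obtain a' b' c' where abc: "w = normal_word a' b' c'" using g(2) by blast
        \<comment> \<open>Words in the support with fewer than \<open>c\<close> letters
          \<open>GXp\<close> are excluded by the induction hypothesis.\<close>
        have "c \<le> c'" 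
          by (rule ccontr) (use less w abc in auto)
        moreover have "\<not> (c = c' \<and> a = a')" using w abc by (auto simp: B_def)
        ultimately show "t w = 0" by (auto simp: t_def abc word_act_normal_word)
      qed
    qed (use g(1) in \<open>auto simp: B_def free_alg_simps\<close>)
    also have "\<dots> = (\<Sum>b\<in>B. t (normal_word a b c))"
      using inj by (subst sum.reindex) (auto intro: inj_on_subset)
    also have "\<dots> = poly p (of_int n) * K"
      by (simp add: t_def word_act_normal_word p_def poly_sum poly_monom K_def sum_distrib_right mult.assoc)
    finally show ?thesis using natC_prod_nth_0[OF n, where 'k = 'k] by (simp add: K_def)
  qed
  have "p = 0"
  proof (rule ccontr)
    assume "p \<noteq> 0"
    then have fin: "finite {x. poly p x = 0}" by (rule poly_roots_finite)
    have "poly p (of_nat (c + m)) = 0" for m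
      using root[of "int (c + m)"] by simp
    then have "range (\<lambda>m. of_nat (c + m)) \<subseteq> {x. poly p x = 0}" by blast
    moreover have "infinite (range (\<lambda>m. of_nat (c + m) :: 'k))"
      by (rule range_inj_infinite) (simp add: inj_on_def)
    ultimately show False using fin finite_subset by blast
  qed
  show ?case
  proof (rule ccontr)
    assume nz: "g (normal_word a b c) \<noteq> 0"
    have "Polynomial.coeff p b = g (normal_word a b c)"
      using finB nz by (simp add: p_def Polynomial.coeff_sum B_def)
    with nz \<open>p = 0\<close> show False by simp
  qed
qed

text \<open>The underlying identity is \<open>(k+1)(n-k) - k(n-k+1) = n - 2k\<close>.\<close>

lemma rel_sl2_in_fa_ann_natC: "rel_sl2 \<in> fa_ann natC"
proof -
  have "fa_act natC n rel_sl2 c k = (0 :: 'a fps)" for n c k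
    by (simp add: rel_sl2_eq fa_act_diff fa_diff_closed fa_word_closed fa_act_word word_act_Cons
        word_act_Nil gen_act_def natC_def of_nat_diff) (auto simp: algebra_simps)
  then show ?thesis by (auto simp: fa_ann_def rel_closed)
qed

lemma Isl2_subset_fa_ann_natC: "Isl2 \<subseteq> fa_ann natC"
  unfolding Isl2_def using rel_in_fa_ann rel_sl2_in_fa_ann_natC
  by (intro FA.genideal_minimal ideal_fa_ann) auto

text \<open>Condition (C1) on colourings, imposed also at \<open>k = 0\<close>. It lets one argument
  modulo h serve both \<open>natC\<close> and \<open>qC\<close>.\<close>

definition deforms_natC :: "(nat \<Rightarrow> int \<Rightarrow> 'k::field_char_0 fps) \<Rightarrow> bool" where
  "deforms_natC psi \<longleftrightarrow> (\<forall>k n. fps_nth (psi k n) 0 = of_int (int k * (n - int k + 1)))"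

lemma deforms_natC_natC: "deforms_natC natC"
  by (simp add: deforms_natC_def natC_def fps_of_int[symmetric])

lemma deforms_natC_qC: "deforms_natC qC"
  by (simp add: deforms_natC_def qC_nth_0)

lemma fa_act_nth_0:
  assumes "deforms_natC psi"
  shows "fps_nth (fa_act psi n f c k) 0 = fps_nth (fa_act natC n f c k) 0"
proof -
  \<comment> \<open>Two vectors that agree modulo h are compared, since the actions of a word under
    \<open>psi\<close> and \<open>natC\<close> agree only modulo h.\<close>
  have "fps_nth (gen_act psi n g v k) 0 = fps_nth (gen_act natC n g v' k) 0"
    if "\<And>k. fps_nth (v k) 0 = fps_nth (v' k) 0" for g v v' k
    using that assms deforms_natC_natC[where 'a = 'a] by (cases g) (simp_all add: gen_act_def deforms_natC_def)
  then have "fps_nth (word_act psi n w c k) 0 = fps_nth (word_act natC n w c k) 0" for w k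
    by (induction w arbitrary: k) (simp_all add: word_act_Nil word_act_Cons)
  then show ?thesis by (simp add: fa_act_def fps_sum_nth)
qed

text \<open>The straightened form \<open>g\<close> differs from \<open>f\<close> by an element of
  \<open>Isl2\<close>, so it acts like \<open>f\<close> under \<open>natC\<close>;
  \<open>normal_coeff_eq_0\<close> then forces \<open>g = 0\<close>.\<close>

lemma Isl2_if_acts_zero:
  assumes psi: "deforms_natC psi" and f: "f \<in> carrier free_alg"
    and act: "\<And>n c k. c \<in> Vh \<Longrightarrow> fps_nth (fa_act psi n f c k) 0 = 0"
  shows "f \<in> Isl2"
proof -
  obtain g where g: "g \<in> carrier free_alg" "\<forall>w. g w \<noteq> 0 \<longrightarrow> (\<exists>a b c. w = normal_word a b c)"
      "(\<lambda>w. f w - g w) \<in> Isl2"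
    using straight_all[OF f] by (auto simp: straight_def)
  have "(\<lambda>w. f w - g w) \<in> fa_ann natC" using g(3) Isl2_subset_fa_ann_natC by blast
  then have "fa_act natC n f c k = fa_act natC n g c k" for n c k
    using f g(1) by (simp add: fa_ann_def fa_act_diff fun_eq_iff)
  then have "fps_nth (fa_act natC n g c k) 0 = 0" if "c \<in> Vh" for n c k
    using act[OF that, of n k] fa_act_nth_0[OF psi, of n f c k] by simp
  then have "g (normal_word a b c) = 0" for a b c
    using normal_coeff_eq_0[OF g(1) g(2)[rule_format]] by blast
  then have "g w = 0" for w using g(2)[rule_format, of w] by fastforce
  then show ?thesis using g(3) by simp
qed

lemma Ann_nth_0:
  assumes psi: "deforms_natC psi" and x: "x \<in> Ann psi"
  shows "\<exists>f\<in>Isl2. x 0 = cls f"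
proof -
  have xc: "x \<in> carrier Uha" using x by (simp add: Ann_def)
  obtain f where f: "\<And>n. f n \<in> carrier free_alg" "x = (\<lambda>n. cls (f n))"
    using carrier_Uha_ex_cls[OF xc] by blast
  have "fps_nth (fa_act psi n (f 0) c k) 0 = 0" if "c \<in> Vh" for n c k
  proof -
    have "fps_nth (Uha_act psi n x c k) 0 = 0" using x that by (simp add: Ann_def)
    then show ?thesis by (simp add: f(2) Uha_act_cls[OF f(1)] hsum_def)
  qed
  then have "f 0 \<in> Isl2" by (intro Isl2_if_acts_zero[OF psi f(1)])
  then show ?thesis using f(2) by auto
qed

section \<open>The quantum algebra\<close>

text \<open>\<open>y\<close> is h times the shifted series, and multiplication by h is injective on
  coordinates.\<close>

lemma Ann_shift:
  assumes y: "y \<in> Ann psi" and y0: "y 0 = \<zero>\<^bsub>Ua\<^esub>"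
  shows "(\<lambda>n. y (Suc n)) \<in> Ann psi"
proof -
  let ?x = "\<lambda>n. y (Suc n)"
  have yc: "y \<in> carrier Uha" using y by (simp add: Ann_def)
  then have x: "?x \<in> carrier Uha" by (simp add: Uha_simps)
  have eq: "Uh_scal fps_X \<otimes>\<^bsub>Uha\<^esub> ?x = y"
    unfolding Uh_scal_X_mult[OF x] using y0 by (intro ext) simp
  have "Uha_act psi n y c = (\<lambda>k. fps_X * Uha_act psi n ?x c k)" for n c
    using Uha_act_scal_mult[OF x, of psi n fps_X c] unfolding eq .
  then have "Uha_act psi n ?x c = (\<lambda>k. 0)" if "c \<in> Vh" for n c
    using y that by (simp add: Ann_def fun_eq_iff)
  then show ?thesis using x by (simp add: Ann_def)
qed

text \<open>\<open>Ann qC\<close> belongs to the intersected family, which is therefore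
  nonempty.\<close>

lemma ideal_Jq: "ideal Jq Uha"
  unfolding Jq_def using ideal_Ann[of qC] hadic_closed_Ann[of qC] Uh_rel_in_Ann_qC
  by (intro Uha.i_Intersect) auto

lemma Uh_rel_in_Jq: "Uh_rel \<in> Jq"
  by (simp add: Jq_def)

lemma Jq_subset_Ann: "Jq \<subseteq> Ann qC"
  unfolding Jq_def using ideal_Ann[of qC] hadic_closed_Ann[of qC] Uh_rel_in_Ann_qC by blast

lemma hadic_closed_Jq: "hadic_closed Jq"
  unfolding hadic_closed_def
proof (intro ballI impI)
  fix x :: "nat \<Rightarrow> 'a fa set"
  assume x: "x \<in> carrier Uha" and lim: "\<forall>N. \<exists>g\<in>Jq. \<forall>n<N. x n = g n"
  have "x \<in> I" if I: "ideal I Uha" "hadic_closed I" "Uh_rel \<in> I" for I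
  proof -
    have "Jq \<subseteq> I" unfolding Jq_def using I by (intro Inter_lower) simp
    then have "\<exists>g\<in>I. \<forall>n<N. x n = g n" for N
      using spec[OF lim, of N] by (elim bexE) (rule bexI, assumption, rule subsetD)
    then show ?thesis using I(2) x unfolding hadic_closed_def by simp
  qed
  then show "x \<in> Jq" by (simp add: Jq_def)
qed

lemma Uha_mult_nth_0:
  assumes "x \<in> carrier Uha" "y \<in> carrier Uha"
  shows "(x \<otimes>\<^bsub>Uha\<^esub> y) 0 = x 0 \<otimes>\<^bsub>Ua\<^esub> y 0"
  by (subst Uha_mult_single[OF assms, where j = 0]) auto

text \<open>At \<open>h = 0\<close> the quantum relation specializes to the classical one, because
  \<open>qH_quot\<close> has constant term \<open>GH\<close>.\<close>

lemma Uh_rel_nth_0: "Uh_rel 0 = cls rel_sl2"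
proof -
  have gen: "Uh_gen g \<in> carrier (Uha :: (nat \<Rightarrow> 'a fa set) ring)" for g
    by (simp add: Uh_gen_eq Uh_const_closed fa_gen_closed)
  have prod: "(Uh_gen g \<otimes>\<^bsub>Uha\<^esub> Uh_gen h) 0 = (cls (fa_word [g, h]) :: 'a fa set)" for g h
    unfolding Uha_mult_nth_0[OF gen gen]
    by (simp add: Uh_gen_def cls_mult fa_gen_closed) (simp add: fa_gen_eq_word fa_mult_word_word)
  show ?thesis
    unfolding Uh_rel_def
    by (simp add: Uha_minus gen qH_quot_props(1) prod qH_quot_nth_0 fa_gen_eq_word cls_diff
        fa_word_closed fa_diff_closed rel_sl2_eq)
qed

text \<open>The liftable elements form an ideal \<open>L\<close>, so the three generators suffice:
  the relations of \<open>Ua\<close> lift to zero and \<open>rel_sl2\<close> lifts to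
  \<open>Uh_rel\<close>.\<close>

lemma Isl2_lift:
  assumes "f \<in> (Isl2 :: 'k::field_char_0 fa set)"
  shows "\<exists>z\<in>Jq. z 0 = cls f"
proof -
  define L where "L = {f \<in> carrier free_alg. \<exists>z\<in>Jq. z 0 = cls (f :: 'k fa)}"
  interpret J: ideal Jq "Uha :: (nat \<Rightarrow> 'k fa set) ring" by (rule ideal_Jq)
  have Jzero: "\<exists>z\<in>Jq. z 0 = cls (\<lambda>w. 0 :: 'k)"
    using J.zero_closed by (auto simp: Uha_simps cls_zero intro!: bexI[of _ "\<zero>\<^bsub>Uha\<^esub>"])
  have "ideal L free_alg"
  proof (rule idealI[OF FA.ring_axioms])
    show "subgroup L (add_monoid free_alg)"
    proof (rule FA.add.subgroupI)
      show "L \<noteq> {}" using Jzero fa_zero_closed by (auto simp: L_def)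
    next
      fix a assume "a \<in> L"
      then obtain z where z: "a \<in> carrier free_alg" "z \<in> Jq" "z 0 = cls a" by (auto simp: L_def)
      have "\<zero>\<^bsub>Uha\<^esub> \<ominus>\<^bsub>Uha\<^esub> z \<in> Jq" using z(2) J.zero_closed J.a_inv_closed by (simp add: Uha.minus_eq)
      moreover have "(\<zero>\<^bsub>Uha\<^esub> \<ominus>\<^bsub>Uha\<^esub> z) 0 = cls (\<zero>\<^bsub>free_alg\<^esub> \<ominus>\<^bsub>free_alg\<^esub> a)"
        using z J.Icarr[OF z(2)]
        by (simp add: Uha_minus Uha_simps(4) free_alg_minus)
           (simp add: cls_zero cls_diff fa_zero_closed free_alg_simps(4))
      ultimately show "\<ominus>\<^bsub>free_alg\<^esub> a \<in> L" using z(1) by (auto simp: L_def FA.minus_eq)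
    next
      fix a b assume "a \<in> L" "b \<in> L"
      then obtain y z where "a \<in> carrier free_alg" "y \<in> Jq" "y 0 = cls a"
        "b \<in> carrier free_alg" "z \<in> Jq" "z 0 = cls b" by (auto simp: L_def)
      then show "a \<oplus>\<^bsub>free_alg\<^esub> b \<in> L"
        by (auto simp: L_def Uha_simps cls_add free_alg_simps(5) fa_add_closed
            intro!: bexI[of _ "y \<oplus>\<^bsub>Uha\<^esub> z"])
    qed (simp add: L_def)
  next
    fix a b :: "'k fa" assume "a \<in> L" and b: "b \<in> carrier free_alg"
    then obtain z where z: "a \<in> carrier free_alg" "z \<in> Jq" "z 0 = cls a" by (auto simp: L_def)
    have "(Uh_const b \<otimes>\<^bsub>Uha\<^esub> z) 0 = cls (fa_mult b a)" "(z \<otimes>\<^bsub>Uha\<^esub> Uh_const b) 0 = cls (fa_mult a b)"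
      using z b J.Icarr[OF z(2)] Uh_const_closed[OF b]
      by (simp_all add: Uha_mult_nth_0) (simp_all add: Uh_const_def cls_mult)
    then show "b \<otimes>\<^bsub>free_alg\<^esub> a \<in> L" "a \<otimes>\<^bsub>free_alg\<^esub> b \<in> L"
      using z b J.I_l_closed[OF z(2) Uh_const_closed[OF b]] J.I_r_closed[OF z(2) Uh_const_closed[OF b]]
      by (auto simp: L_def free_alg_simps(2) fa_mult_closed)
  qed
  moreover have "cls rel_Xp = cls (\<lambda>w. 0 :: 'k)" "cls rel_Xm = cls (\<lambda>w. 0 :: 'k)"
    by (simp_all add: cls_eq_iff rel_closed fa_zero_closed rel_in_Ia)
  then have "{rel_Xp, rel_Xm, rel_sl2} \<subseteq> L"
    using Jzero Uh_rel_in_Jq Uh_rel_nth_0 by (auto simp: L_def rel_closed)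
  ultimately have "Isl2 \<subseteq> L" unfolding Isl2_def by (rule FA.genideal_minimal)
  then show ?thesis using assms by (auto simp: L_def)
qed

lemma Ann_qC_approx:
  assumes "x \<in> Ann (qC :: nat \<Rightarrow> int \<Rightarrow> 'k::field_char_0 fps)"
  shows "\<exists>g\<in>Jq. \<forall>n<N. x n = g n"
  using assms
proof (induction N arbitrary: x)
  case 0
  then show ?case using Uh_rel_in_Jq by auto
next
  case (Suc N)
  interpret J: ideal Jq "Uha :: (nat \<Rightarrow> 'k fa set) ring" by (rule ideal_Jq)
  interpret Q: ideal "Ann qC" "Uha :: (nat \<Rightarrow> 'k fa set) ring" by (rule ideal_Ann)
  obtain z where z: "z \<in> Jq" "z 0 = x 0"
    using Ann_nth_0[OF deforms_natC_qC Suc.prems] Isl2_lift by metis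
  have car: "x \<in> carrier Uha" "z \<in> carrier Uha" using Suc.prems z(1) Q.Icarr J.Icarr by auto
  then have nth: "x n \<in> carrier Ua" "z n \<in> carrier Ua" for n by (simp_all add: Uha_simps)
  have "x \<ominus>\<^bsub>Uha\<^esub> z \<in> Ann qC"
    using Suc.prems z(1) Jq_subset_Ann Q.a_closed Q.a_inv_closed by (auto simp: Uha.minus_eq)
  moreover have "(x \<ominus>\<^bsub>Uha\<^esub> z) 0 = \<zero>\<^bsub>Ua\<^esub>"
    using nth z(2) by (simp add: Uha_minus car Ua.minus_eq Ua.r_neg)
  ultimately obtain g where g: "g \<in> Jq" "\<And>n. n < N \<Longrightarrow> (x \<ominus>\<^bsub>Uha\<^esub> z) (Suc n) = g n"
    using Suc.IH[OF Ann_shift] by metis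
  have gc: "g \<in> carrier Uha" using g(1) by (rule J.Icarr)
  \<comment> \<open>\<open>g\<close> approximates the quotient of \<open>x - z\<close> by h in
    \<open>N\<close> coefficients; multiplying by h and adding \<open>z\<close> gains one
    more.\<close>
  have "z \<oplus>\<^bsub>Uha\<^esub> (Uh_scal fps_X \<otimes>\<^bsub>Uha\<^esub> g) \<in> Jq"
    using z(1) g(1) by (simp add: J.a_closed J.I_l_closed Uh_scal_closed)
  moreover have "x n = (z \<oplus>\<^bsub>Uha\<^esub> (Uh_scal fps_X \<otimes>\<^bsub>Uha\<^esub> g)) n" if "n < Suc N" for n
  proof (cases n)
    case 0
    then show ?thesis using z(2) nth by (simp add: Uha_simps(5) Uh_scal_X_mult[OF gc])
  next
    case (Suc m)
    then have "g m = x n \<ominus>\<^bsub>Ua\<^esub> z n" using g(2)[of m] that by (simp add: Uha_minus car)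
    then show ?thesis
      using Suc nth[of n]
      by (simp add: Uha_simps(5) Uh_scal_X_mult[OF gc] Ua.minus_eq Ua.a_lcomm[of "z (Suc m)" "x (Suc m)"] Ua.r_neg)
  qed
  ultimately show ?case by (intro bexI) auto
qed

lemma Jq_eq_Ann_qC: "Jq = Ann (qC :: nat \<Rightarrow> int \<Rightarrow> 'k::field_char_0 fps)"
proof
  show "Ann (qC :: nat \<Rightarrow> int \<Rightarrow> 'k fps) \<subseteq> Jq"
  proof
    fix x :: "nat \<Rightarrow> 'k fa set" assume x: "x \<in> Ann qC"
    then have "x \<in> carrier Uha" by (simp add: Ann_def)
    then show "x \<in> Jq"
      by (rule hadic_closed_Jq[unfolded hadic_closed_def, THEN bspec, THEN mp])
         (intro allI Ann_qC_approx x)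
  qed
qed (rule Jq_subset_Ann)

section \<open>The classical algebra\<close>

definition Ua_to_Usl2 :: "'k::field fa set \<Rightarrow> 'k fa set" where
  "Ua_to_Usl2 C = \<Union>{Isl2 +>\<^bsub>free_alg\<^esub> f | f. f \<in> C}"

lemma sl2_proj_eq: "sl2_proj x = (\<lambda>n. Ua_to_Usl2 (x n))"
  by (simp add: sl2_proj_def Ua_to_Usl2_def)

lemma Usl2_coset_eq_iff:
  assumes "f \<in> carrier free_alg" "g \<in> carrier free_alg"
  shows "Isl2 +>\<^bsub>free_alg\<^esub> f = Isl2 +>\<^bsub>free_alg\<^esub> g \<longleftrightarrow> (\<lambda>w. f w - g w) \<in> Isl2"
  using FA.quotient_eq_iff_same_a_r_cos[OF ideal_Isl2 assms] assms by (simp add: free_alg_minus)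

text \<open>Since \<open>Ia \<subseteq> Isl2\<close>, all representatives give the same coset, and
  the union is over a single set.\<close>

lemma Ua_to_Usl2_cls:
  assumes "f \<in> carrier free_alg"
  shows "Ua_to_Usl2 (cls f) = Isl2 +>\<^bsub>free_alg\<^esub> f"
proof -
  have eq: "Isl2 +>\<^bsub>free_alg\<^esub> g = Isl2 +>\<^bsub>free_alg\<^esub> f" if "g \<in> cls f" for g
  proof -
    from that obtain i where i: "i \<in> Ia" "g = (\<lambda>w. i w + f w)"
      by (auto simp: cls_def a_r_coset_def' free_alg_simps)
    then have "i \<in> Isl2" using Ia_subset_Isl2 by blast
    then show ?thesis
      using assms i by (subst Usl2_coset_eq_iff) (simp_all add: fa_add_closed Isl2_carrier)
  qed
  have "{Isl2 +>\<^bsub>free_alg\<^esub> g | g. g \<in> cls f} = {Isl2 +>\<^bsub>free_alg\<^esub> f}"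
  proof (rule subset_antisym)
    show "{Isl2 +>\<^bsub>free_alg\<^esub> g | g. g \<in> cls f} \<subseteq> {Isl2 +>\<^bsub>free_alg\<^esub> f}"
    proof
      fix C assume "C \<in> {Isl2 +>\<^bsub>free_alg\<^esub> g | g. g \<in> cls f}"
      then obtain g where "C = Isl2 +>\<^bsub>free_alg\<^esub> g" "g \<in> cls f" by (elim CollectE exE conjE)
      then show "C \<in> {Isl2 +>\<^bsub>free_alg\<^esub> f}" by (simp only: eq singleton_iff)
    qed
  qed (use cls_self[OF assms] in auto)
  then show ?thesis by (simp add: Ua_to_Usl2_def)
qed

lemma ring_hom_Ua_to_Usl2: "Ua_to_Usl2 \<in> ring_hom Ua Usl2"
proof -
  note h = ideal.rcos_ring_hom[OF ideal_Isl2, folded Usl2_def]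
  show ?thesis
  proof (rule ring_hom_memI)
    fix C assume "C \<in> carrier (Ua :: 'a fa set ring)"
    then show "Ua_to_Usl2 C \<in> carrier Usl2"
      by (elim carrier_Ua_cases) (simp add: Ua_to_Usl2_cls ring_hom_closed[OF h])
  next
    fix C D assume "C \<in> carrier (Ua :: 'a fa set ring)" "D \<in> carrier (Ua :: 'a fa set ring)"
    then obtain f g where fg: "f \<in> carrier free_alg" "g \<in> carrier free_alg" "C = cls f" "D = cls g"
      by (elim carrier_Ua_cases)
    then show "Ua_to_Usl2 (C \<otimes>\<^bsub>Ua\<^esub> D) = Ua_to_Usl2 C \<otimes>\<^bsub>Usl2\<^esub> Ua_to_Usl2 D"
      using ring_hom_mult[OF h, of f g]
      by (simp add: cls_mult Ua_to_Usl2_cls fa_mult_closed) (simp add: free_alg_simps(2))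
    show "Ua_to_Usl2 (C \<oplus>\<^bsub>Ua\<^esub> D) = Ua_to_Usl2 C \<oplus>\<^bsub>Usl2\<^esub> Ua_to_Usl2 D"
      using ring_hom_add[OF h, of f g] fg
      by (simp add: cls_add Ua_to_Usl2_cls fa_add_closed) (simp add: free_alg_simps(5))
  next
    show "Ua_to_Usl2 \<one>\<^bsub>Ua\<^esub> = (\<one>\<^bsub>Usl2\<^esub> :: 'a fa set)"
      using ring_hom_one[OF h]
      by (simp add: cls_one Ua_to_Usl2_cls fa_word_closed) (simp add: free_alg_simps(3))
  qed
qed

lemma ring_hom_pseries:
  assumes "ring_hom_ring R S h"
  shows "(\<lambda>x n. h (x n)) \<in> ring_hom (pseries R) (pseries S)"
proof -
  interpret ring_hom_ring R S h by fact
  show ?thesis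
    by (rule ring_hom_memI)
       (auto simp: pseries_simps(1,3,4,5) fun_eq_iff pseries_simps(2) Pi_def o_def)
qed

lemma ring_hom_ring_sl2_proj: "ring_hom_ring Uha (pseries Usl2) sl2_proj"
proof (intro ring_hom_ringI2 Uha.ring_axioms Usl2.ring_pseries)
  have "ring_hom_ring Ua Usl2 (Ua_to_Usl2 :: 'a fa set \<Rightarrow> _)"
    by (intro ring_hom_ringI2 Ua.ring_axioms Usl2.ring_axioms ring_hom_Ua_to_Usl2)
  then show "(sl2_proj :: (nat \<Rightarrow> 'a fa set) \<Rightarrow> _) \<in> ring_hom Uha (pseries Usl2)"
    unfolding sl2_proj_eq[abs_def] Uha_def by (rule ring_hom_pseries)
qed

lemma sl2_proj_surj: "sl2_proj ` carrier Uha = carrier (pseries Usl2)"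
proof
  show "sl2_proj ` carrier Uha \<subseteq> carrier (pseries Usl2)"
    using ring_hom_closed[OF ring_hom_ring.homh[OF ring_hom_ring_sl2_proj]] by blast
  show "carrier (pseries Usl2) \<subseteq> sl2_proj ` carrier Uha"
  proof
    fix y assume "y \<in> carrier (pseries Usl2)"
    then have "\<forall>n. \<exists>f. f \<in> carrier free_alg \<and> y n = Isl2 +>\<^bsub>free_alg\<^esub> f"
      by (auto simp: pseries_simps Usl2_def FactRing_def A_RCOSETS_def')
    then have "\<exists>f. \<forall>n. f n \<in> carrier free_alg \<and> y n = Isl2 +>\<^bsub>free_alg\<^esub> f n" by (rule choice)
    then obtain f where f: "\<forall>n. f n \<in> carrier free_alg \<and> y n = Isl2 +>\<^bsub>free_alg\<^esub> f n" ..
    then have "sl2_proj (\<lambda>n. cls (f n)) = y" by (simp add: sl2_proj_eq Ua_to_Usl2_cls fun_eq_iff)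
    then show "y \<in> sl2_proj ` carrier Uha"
      using f by (intro image_eqI[of _ _ "\<lambda>n. cls (f n)"]) (auto intro!: cls_in_Uha)
  qed
qed

lemma Uh_const_in_Ann:
  assumes "f \<in> fa_ann psi"
  shows "Uh_const f \<in> Ann psi"
proof -
  have "f \<in> carrier free_alg" using assms by (simp add: fa_ann_def)
  then show ?thesis
    using assms by (auto simp: Ann_def fa_ann_def Uh_const_closed Uha_act_const)
qed

lemma Uha_minus_const:
  assumes "x \<in> carrier Uha" "f \<in> carrier free_alg" "x 0 = cls f"
  shows "(x \<ominus>\<^bsub>Uha\<^esub> Uh_const f) m = (if m = 0 then \<zero>\<^bsub>Ua\<^esub> else x m)"
proof -
  have "x m \<in> carrier Ua" using assms by (simp add: Uha_simps)
  then show ?thesis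
    using assms(2,3) unfolding Uha_minus[OF assms(1) Uh_const_closed[OF assms(2)]]
    by (simp add: Uh_const_def cls_zero[symmetric] Ua.minus_eq Ua.r_neg cls_closed)
qed

text \<open>For \<open>natC\<close> the constant series of an element of \<open>Isl2\<close> already
  annihilates, so it can be subtracted without touching the higher coefficients.\<close>

lemma Ann_natC_nth:
  assumes "x \<in> Ann (natC :: nat \<Rightarrow> int \<Rightarrow> 'k::field_char_0 fps)"
  shows "\<exists>f\<in>Isl2. x n = cls f"
  using assms
proof (induction n arbitrary: x)
  case 0
  then show ?case by (rule Ann_nth_0[OF deforms_natC_natC])
next
  case (Suc n)
  obtain f where f: "f \<in> Isl2" "x 0 = cls f" using Ann_nth_0[OF deforms_natC_natC Suc.prems] by blast
  have fc: "f \<in> carrier free_alg" using f(1) by (rule Isl2_carrier)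
  have xc: "x \<in> carrier Uha" using Suc.prems by (simp add: Ann_def)
  have "f \<in> fa_ann natC" using f(1) Isl2_subset_fa_ann_natC by blast
  then have "Uh_const f \<in> Ann natC" by (rule Uh_const_in_Ann)
  then have "x \<ominus>\<^bsub>Uha\<^esub> Uh_const f \<in> Ann natC"
    using Suc.prems by (simp add: Ann_def Uha_act_minus)
  then have "(\<lambda>m. (x \<ominus>\<^bsub>Uha\<^esub> Uh_const f) (Suc m)) \<in> Ann natC"
    by (rule Ann_shift) (simp add: Uha_minus_const[OF xc fc f(2)])
  from Suc.IH[OF this] show ?case by (simp add: Uha_minus_const[OF xc fc f(2)])
qed

text \<open>Both sides describe the series whose coefficients are all classes of elements of
  \<open>Isl2\<close>.\<close>

lemma kernel_sl2_proj:
  "a_kernel Uha (pseries Usl2) sl2_proj = Ann (natC :: nat \<Rightarrow> int \<Rightarrow> 'k::field_char_0 fps)"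
proof -
  have zero: "\<zero>\<^bsub>Usl2\<^esub> = Isl2 +>\<^bsub>free_alg\<^esub> (\<lambda>w. 0 :: 'k)"
    using ring_hom_zero[OF ring_hom_Ua_to_Usl2 Ua.ring_axioms Usl2.ring_axioms, symmetric]
    by (simp add: cls_zero Ua_to_Usl2_cls fa_zero_closed)
  have iff: "sl2_proj (\<lambda>n. cls (f n)) = \<zero>\<^bsub>pseries Usl2\<^esub> \<longleftrightarrow> (\<forall>n. f n \<in> Isl2)"
    if "\<And>n. f n \<in> carrier free_alg" for f :: "nat \<Rightarrow> 'k fa"
  proof -
    have "sl2_proj (\<lambda>n. cls (f n)) n = \<zero>\<^bsub>pseries Usl2\<^esub> n \<longleftrightarrow> f n \<in> Isl2" for n
      by (simp only: sl2_proj_eq Ua_to_Usl2_cls[OF that] pseries_simps(4) zero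
          Usl2_coset_eq_iff[OF that fa_zero_closed] diff_zero)
    then show ?thesis unfolding fun_eq_iff[of "sl2_proj _"] by simp
  qed
  show ?thesis
  proof (rule Set.set_eqI)
    fix x :: "nat \<Rightarrow> 'k fa set"
    have "x \<in> Ann natC \<longleftrightarrow> sl2_proj x = \<zero>\<^bsub>pseries Usl2\<^esub>" if xc: "x \<in> carrier Uha"
    proof
      assume "x \<in> Ann natC"
      from Ann_natC_nth[OF this] have "\<forall>n. \<exists>f. f \<in> Isl2 \<and> x n = cls f" by blast
      then have "\<exists>f. \<forall>n. f n \<in> Isl2 \<and> x n = cls (f n)" by (rule choice)
      then obtain f where f: "\<forall>n. f n \<in> Isl2 \<and> x n = cls (f n)" ..
      then have "x = (\<lambda>n. cls (f n))" by auto
      then show "sl2_proj x = \<zero>\<^bsub>pseries Usl2\<^esub>" 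
        using iff[of f] f by (simp add: Isl2_carrier)
    next
      assume *: "sl2_proj x = \<zero>\<^bsub>pseries Usl2\<^esub>"
      obtain f where f: "\<And>n. f n \<in> carrier free_alg" "x = (\<lambda>n. cls (f n))"
        using carrier_Uha_ex_cls[OF xc] by blast
      have "f n \<in> Isl2" for n
        using iff[OF f(1)] * unfolding f(2) by simp
      then have "f n \<in> fa_ann natC" for n
        using Isl2_subset_fa_ann_natC by (rule subsetD[rotated])
      then show "x \<in> Ann natC"
        using xc unfolding f(2) by (simp add: Ann_def Uha_act_cls f(1) fa_ann_def hsum_zero)
    qed
    then show "x \<in> a_kernel Uha (pseries Usl2) sl2_proj \<longleftrightarrow> x \<in> Ann natC"
      unfolding a_kernel_def' by (auto simp: Ann_def)
  qed
qed

theorem mainTheorem9: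
  shows "Uha_alg_iso (pseries Usl2) sl2_proj
           (Uh_psi (natC :: nat \<Rightarrow> int \<Rightarrow> 'k::field_char_0 fps)) (quot_proj (Ann natC))
       \<and> Uha_alg_iso (Uh_sl2 :: ((nat \<Rightarrow> 'k fa set) set) ring) (quot_proj Jq)
           (Uh_psi (qC :: nat \<Rightarrow> int \<Rightarrow> 'k fps)) (quot_proj (Ann qC))"
proof
  let ?p = "sl2_proj :: (nat \<Rightarrow> 'k fa set) \<Rightarrow> _"
  let ?Q = "Uha Quot Ann (natC :: nat \<Rightarrow> int \<Rightarrow> 'k fps)"
  let ?h = "\<lambda>C. the_elem (?p ` C)"
  note hom = ring_hom_ring_sl2_proj[where 'a = 'k]
  \<comment> \<open>The first isomorphism theorem yields a map out of the quotient; its inverse has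
    the required direction.\<close>
  have iso: "?h \<in> ring_iso ?Q (pseries Usl2)"
    using ring_hom_ring.FactRing_iso_set[OF hom sl2_proj_surj] unfolding kernel_sl2_proj .
  \<comment> \<open>Compatibility with the structural maps passes to the inverse because
    \<open>?h\<close> sends the class of \<open>x\<close> to \<open>?p x\<close>.\<close>
  have "inv_into (carrier ?Q) ?h (?p x) = quot_proj (Ann natC) x" if x: "x \<in> carrier Uha" for x
  proof -
    have "?h (quot_proj (Ann natC) x) = ?p x"
      using ring_hom_ring.the_elem_simp[OF hom x] unfolding kernel_sl2_proj quot_proj_def .
    moreover have "quot_proj (Ann natC) x \<in> carrier ?Q"
      using x by (auto simp: quot_proj_def FactRing_def A_RCOSETS_def')
    moreover have "inj_on ?h (carrier ?Q)"
      using iso by (auto simp: ring_iso_def bij_betw_def)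
    ultimately show ?thesis by (metis inv_into_f_f)
  qed
  moreover have "inv_into (carrier ?Q) ?h \<in> ring_iso (pseries Usl2) ?Q"
    using iso by (rule ring_iso_set_sym[OF ideal.quotient_is_ring[OF ideal_Ann]])
  ultimately show "Uha_alg_iso (pseries Usl2) ?p (Uh_psi natC) (quot_proj (Ann natC))"
    unfolding Uha_alg_iso_def Uh_psi_def by blast
  show "Uha_alg_iso (Uh_sl2 :: ((nat \<Rightarrow> 'k fa set) set) ring) (quot_proj Jq)
      (Uh_psi qC) (quot_proj (Ann qC))"
    \<comment> \<open>The two ideals coincide, so both quotients are the same ring and the identity
      is the isomorphism.\<close>
    unfolding Uha_alg_iso_def Uh_sl2_def Uh_psi_def Jq_eq_Ann_qC
    by (intro exI[of _ id]) (auto simp: ring_iso_def ring_hom_def)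
qed

end
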